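(* Let $A$ be a $(\mathbb{Z}_2)^n_{\,0}$-graded commutative associative unital algebra such that each subspace $A^\gamma$ contains at least one invertible element. Let $q_0=2^{n-1}$, $\mathbf{r}_0=(r_1,\dots,r_{q_0})\in\mathbb{N}^{q_0}$ and $|\mathbf{r}|=r_1+\dots+r_{q_0}$. For a homogeneous matrix $X\in\mathsf{M}^\gamma(\mathbf{r}_0;A)$ of degree $\gamma\in(\mathbb{Z}_2)^n_{\,0}$, written as $X=q\,X_0$ with $q\in A^\gamma$ invertible and $X_0\in\mathsf{M}^0(\mathbf{r}_0;A)$, put $$\Gamma\!\det(X):=q^{|\mathbf{r}|}\,\Gamma\!\det(X_0)\in A^{|\mathbf{r}|\gamma}$$ (this is independent of the choice of $q$). Then the graded determinant so defined is multiplicative, $$\Gamma\!\det(XY)=\Gamma\!\det(X)\cdot\Gamma\!\det(Y)$$ for any purely even homogeneous $(|\mathbf{r}|\times|\mathbf{r}|)$-matrices $X,Y$ (i.e. homogeneous elements, of arbitrary degrees in $(\mathbb{Z}_2)^n_{\,0}$, of $\mathsf{M}(\mathbf{r}_0;A)$), if and only if $|\mathbf{r}|\equiv0$ or $1\pmod 4$.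
   Context: The group $(\mathbb{Z}_2)^n$ carries the $\mathbb{Z}_2$-valued scalar product $\langle\gamma,\gamma'\rangle=\sum_i\gamma_i\gamma'_i$; $(\mathbb{Z}_2)^n_{\,0}$ is the subgroup of even elements ($\langle\gamma,\gamma\rangle=0$), listed lexicographically as $\gamma_1=0,\dots,\gamma_{q_0}$. A $(\mathbb{Z}_2)^n_{\,0}$-graded commutative algebra is an associative unital algebra $A=\bigoplus_{\gamma\in(\mathbb{Z}_2)^n_0}A^\gamma$ over a field of characteristic $0$ with $A^\gamma A^\delta\subset A^{\gamma+\delta}$ and $ba=(-1)^{\langle\tilde a,\tilde b\rangle}ab$ for homogeneous $a,b$ of degrees $\tilde a,\tilde b$. $\mathsf{M}^x(\mathbf{r}_0;A)$ is the space of $q_0\times q_0$ block matrices $X=(X_{ku})$ with $X_{ku}$ of size $r_k\times r_u$ and entries in $A^{\gamma_k+\gamma_u+x}$, and $\mathsf{M}(\mathbf{r}_0;A)=\bigoplus_x\mathsf{M}^x(\mathbf{r}_0;A)$ with the usual matrix product. Multiplication of a matrix by a homogeneous scalar $a\in A$ is the graded one: $(aX)_{ku}=(-1)^{\langle\tilde a,\gamma_k\rangle}a\,X_{ku}$. On degree $0$ matrices the graded determinant is the unique map $\Gamma\!\det:\mathsf{M}^0(\mathbf{r}_0;A)\to A^0$ that is multiplicative, equals $\prod_k\det(X_{kk})$ on block-diagonal matrices, and equals $1$ on block-unitriangular matrices (block triangular with identity diagonal blocks). Explicitly it is the polynomial in the entries of $X$ which coincides with $\prod_{k=0}^{q_0-1}\det|X^{1\ldots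 k,1\ldots k}|_{k+1\,k+1}$ whenever the inverses involved exist, where $X^{1\ldots k,1\ldots k}$ is $X$ with its first $k$ block rows and columns deleted, and $|X^{1\ldots k,1\ldots k}|_{k+1\,k+1}=X_{k+1,k+1}-(X_{k+1,b})_{b>k+1}(X^{1\ldots k+1,1\ldots k+1})^{-1}(X_{a,k+1})_{a>k+1}$.
   Formalization: The "only if" direction is stated only for n ≥ 3: for n = 1, 2 the scalar product vanishes on even elements, so A is commutative and Γdet is multiplicative for every |r| (e.g. n = 2, A = K[Z_2], r = (1,1)); the "if" direction is stated for all n ≥ 1. A is taken nonzero. *)

theory Defs
  imports "HOL-Library.Z2" "HOL-Library.FuncSet" "HOL-Combinatorics.Permutations"
    "Jordan_Normal_Form.Matrix"
begin

text \<open>Elements of $(\mathbb{Z}_2)^n$ are lists of length \<open>n\<close> over the two-element field \<open>bit\<close>.\<close>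

type_synonym degree = "bit list"

definition deg_zero :: "nat \<Rightarrow> degree" where
  "deg_zero n = replicate n 0"

definition deg_add :: "degree \<Rightarrow> degree \<Rightarrow> degree" (infixl "\<oplus>\<^sub>d" 65) where
  "\<gamma> \<oplus>\<^sub>d \<delta> = map2 (+) \<gamma> \<delta>"

definition sprod :: "degree \<Rightarrow> degree \<Rightarrow> bit" where
  "sprod \<gamma> \<delta> = sum_list (map2 (*) \<gamma> \<delta>)"

definition gsign :: "degree \<Rightarrow> degree \<Rightarrow> 'a::ring_1" where
  "gsign \<gamma> \<delta> = (if sprod \<gamma> \<delta> = 0 then 1 else - 1)"

text \<open>\<open>product_lists\<close> enumerates in lexicographic order, the first component varying slowest.
  The degree $\gamma_{k+1}$ of the mathematical text is \<open>even_degs n ! k\<close>.\<close>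

definition even_degs :: "nat \<Rightarrow> degree list" where
  "even_degs n = filter (\<lambda>\<gamma>. sprod \<gamma> \<gamma> = 0) (product_lists (replicate n [0, 1]))"

abbreviation Even_degs :: "nat \<Rightarrow> degree set" where
  "Even_degs n \<equiv> set (even_degs n)"

text \<open>The algebra is the whole type \<open>'a\<close> (so it is nonzero), an algebra over the field \<open>'k\<close>
  through \<open>scale\<close>.\<close>

locale graded_comm_algebra = vector_space scale
  for scale :: "'k::field_char_0 \<Rightarrow> 'a::ring_1 \<Rightarrow> 'a" +
  fixes n :: nat and A :: "degree \<Rightarrow> 'a set"
  assumes scale_mult_left: "scale c (x * y) = scale c x * y"
    and scale_mult_right: "scale c (x * y) = x * scale c y"
    and subspace_component: "\<gamma> \<in> Even_degs n \<Longrightarrow> subspace (A \<gamma>)"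
    and direct_sum: "\<exists>!f. f \<in> (\<Pi>\<^sub>E \<gamma>\<in>Even_degs n. A \<gamma>) \<and> x = (\<Sum>\<gamma>\<in>Even_degs n. f \<gamma>)"
    and component_mult: "\<lbrakk>\<gamma> \<in> Even_degs n; \<delta> \<in> Even_degs n; a \<in> A \<gamma>; b \<in> A \<delta>\<rbrakk>
      \<Longrightarrow> a * b \<in> A (\<gamma> \<oplus>\<^sub>d \<delta>)"
    and graded_commute: "\<lbrakk>\<gamma> \<in> Even_degs n; \<delta> \<in> Even_degs n; a \<in> A \<gamma>; b \<in> A \<delta>\<rbrakk>
      \<Longrightarrow> b * a = gsign \<gamma> \<delta> * (a * b)"

definition invertible_elem :: "'a::monoid_mult \<Rightarrow> bool" where
  "invertible_elem q \<longleftrightarrow> (\<exists>q'. q * q' = 1 \<and> q' * q = 1)"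

text \<open>A block matrix with block sizes \<open>r\<close> is stored as one square matrix of size \<open>sum_list r\<close>;
  block \<open>k\<close> (counted from \<open>0\<close>) occupies the \<open>r ! k\<close> rows and columns starting at
  \<open>offset r k\<close>.\<close>

definition offset :: "nat list \<Rightarrow> nat \<Rightarrow> nat" where
  "offset r k = sum_list (take k r)"

definition block_of :: "nat list \<Rightarrow> nat \<Rightarrow> nat" where
  "block_of r i = (LEAST k. i < offset r (Suc k))"

definition row_deg :: "nat \<Rightarrow> nat list \<Rightarrow> nat \<Rightarrow> degree" where
  "row_deg n r i = even_degs n ! block_of r i"

definition graded_mats ::
  "nat \<Rightarrow> (degree \<Rightarrow> 'a::ring_1 set) \<Rightarrow> nat list \<Rightarrow> degree \<Rightarrow> 'a mat set" where
  "graded_mats n A r x = {X \<in> carrier_mat (sum_list r) (sum_list r).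
     \<forall>i < sum_list r. \<forall>j < sum_list r. X $$ (i, j) \<in> A (row_deg n r i \<oplus>\<^sub>d row_deg n r j \<oplus>\<^sub>d x)}"

text \<open>Left multiplication of a matrix by a scalar \<open>a\<close> that is homogeneous of degree \<open>\<gamma>\<close>.\<close>

definition graded_smult ::
  "nat \<Rightarrow> nat list \<Rightarrow> degree \<Rightarrow> 'a::ring_1 \<Rightarrow> 'a mat \<Rightarrow> 'a mat" where
  "graded_smult n r \<gamma> a X = mat (sum_list r) (sum_list r)
     (\<lambda>(i, j). gsign \<gamma> (row_deg n r i) * a * X $$ (i, j))"

definition window :: "'a mat \<Rightarrow> nat \<Rightarrow> nat \<Rightarrow> nat \<Rightarrow> nat \<Rightarrow> 'a mat" where
  "window X i h j w = mat h w (\<lambda>(a, b). X $$ (i + a, j + b))"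

definition block :: "nat list \<Rightarrow> 'a mat \<Rightarrow> nat \<Rightarrow> nat \<Rightarrow> 'a mat" where
  "block r X k u = window X (offset r k) (r ! k) (offset r u) (r ! u)"

text \<open>The Leibniz determinant. It is used only for matrices whose entries lie in the commutative
  subring $A^0$; the library determinant needs a commutative ring type.\<close>

definition leibniz_det :: "'a::ring_1 mat \<Rightarrow> 'a" where
  "leibniz_det B = (\<Sum>p | p permutes {0..<dim_row B}.
     of_int (sign p) * prod_list (map (\<lambda>i. B $$ (i, p i)) [0..<dim_row B]))"

definition block_diagonal :: "nat list \<Rightarrow> 'a::zero mat \<Rightarrow> bool" where
  "block_diagonal r X \<longleftrightarrow> (\<forall>i < sum_list r. \<forall>j < sum_list r.
     block_of r i \<noteq> block_of r j \<longrightarrow> X $$ (i, j) = 0)"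

definition block_upper_triangular :: "nat list \<Rightarrow> 'a::zero mat \<Rightarrow> bool" where
  "block_upper_triangular r X \<longleftrightarrow> (\<forall>i < sum_list r. \<forall>j < sum_list r.
     block_of r j < block_of r i \<longrightarrow> X $$ (i, j) = 0)"

definition block_lower_triangular :: "nat list \<Rightarrow> 'a::zero mat \<Rightarrow> bool" where
  "block_lower_triangular r X \<longleftrightarrow> (\<forall>i < sum_list r. \<forall>j < sum_list r.
     block_of r i < block_of r j \<longrightarrow> X $$ (i, j) = 0)"

definition block_unitriangular :: "nat list \<Rightarrow> 'a::{zero,one} mat \<Rightarrow> bool" where
  "block_unitriangular r X \<longleftrightarrow>
     (block_upper_triangular r X \<or> block_lower_triangular r X) \<and>
     (\<forall>k < length r. block r X k k = 1\<^sub>m (r ! k))"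

text \<open>\<open>tail r X k\<close> is \<open>X\<close> with its first \<open>k\<close> block rows and block columns deleted.\<close>

definition tail :: "nat list \<Rightarrow> 'a mat \<Rightarrow> nat \<Rightarrow> 'a mat" where
  "tail r X k = (let t = sum_list r - offset r k in window X (offset r k) t (offset r k) t)"

definition mat_inverse_of :: "'a::ring_1 mat \<Rightarrow> 'a mat \<Rightarrow> bool" where
  "mat_inverse_of B Z \<longleftrightarrow> Z \<in> carrier_mat (dim_col B) (dim_row B) \<and> inverts_mat B Z \<and> inverts_mat Z B"

text \<open>The quasideterminant at the upper left block of \<open>tail r X k\<close>, where \<open>Z\<close> is the inverse of
  \<open>tail r X (Suc k)\<close>.\<close>

definition quasidet :: "nat list \<Rightarrow> 'a::ring_1 mat \<Rightarrow> nat \<Rightarrow> 'a mat \<Rightarrow> 'a mat" where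
  "quasidet r X k Z =
     (let o1 = offset r k; o2 = offset r (Suc k); t = sum_list r - o2 in
      block r X k k - window X o1 (r ! k) o2 t * Z * window X o2 t o1 (r ! k))"

inductive entry_polynomial ::
  "('k \<Rightarrow> 'a::ring_1 \<Rightarrow> 'a) \<Rightarrow> nat \<Rightarrow> ('a mat \<Rightarrow> 'a) \<Rightarrow> bool"
  for scale :: "'k \<Rightarrow> 'a \<Rightarrow> 'a" and N :: nat where
  const: "entry_polynomial scale N (\<lambda>X. scale c 1)"
| entry: "i < N \<Longrightarrow> j < N \<Longrightarrow> entry_polynomial scale N (\<lambda>X. X $$ (i, j))"
| add: "entry_polynomial scale N p \<Longrightarrow> entry_polynomial scale N p'
    \<Longrightarrow> entry_polynomial scale N (\<lambda>X. p X + p' X)"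
| mult: "entry_polynomial scale N p \<Longrightarrow> entry_polynomial scale N p'
    \<Longrightarrow> entry_polynomial scale N (\<lambda>X. p X * p' X)"

text \<open>The three characteristic properties of the graded determinant on degree \<open>0\<close> matrices, together
  with its being a polynomial in the entries that is given by the product of determinants of
  quasideterminants whenever the inverses in that product exist. Polynomiality is what makes the map
  unique over one fixed algebra.\<close>

definition is_gdet0 ::
  "('k \<Rightarrow> 'a::ring_1 \<Rightarrow> 'a) \<Rightarrow> nat \<Rightarrow> (degree \<Rightarrow> 'a set) \<Rightarrow> nat list \<Rightarrow> ('a mat \<Rightarrow> 'a) \<Rightarrow> bool" where
  "is_gdet0 scale n A r d \<longleftrightarrow>
     (let M0 = graded_mats n A r (deg_zero n) in
      d \<in> M0 \<rightarrow>\<^sub>E A (deg_zero n) \<and>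
      (\<forall>X\<in>M0. \<forall>Y\<in>M0. d (X * Y) = d X * d Y) \<and>
      (\<forall>X\<in>M0. block_diagonal r X \<longrightarrow>
         d X = prod_list (map (\<lambda>k. leibniz_det (block r X k k)) [0..<length r])) \<and>
      (\<forall>X\<in>M0. block_unitriangular r X \<longrightarrow> d X = 1) \<and>
      (\<exists>p. entry_polynomial scale (sum_list r) p \<and> (\<forall>X\<in>M0. d X = p X)) \<and>
      (\<forall>X\<in>M0. \<forall>Z. (\<forall>k < length r. mat_inverse_of (tail r X (Suc k)) (Z k)) \<longrightarrow>
         d X = prod_list (map (\<lambda>k. leibniz_det (quasidet r X k (Z k))) [0..<length r])))"

definition gdet0 ::
  "('k \<Rightarrow> 'a::ring_1 \<Rightarrow> 'a) \<Rightarrow> nat \<Rightarrow> (degree \<Rightarrow> 'a set) \<Rightarrow> nat list \<Rightarrow> 'a mat \<Rightarrow> 'a" where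
  "gdet0 scale n A r = (THE d. is_gdet0 scale n A r d)"

text \<open>\<open>factorization n A r \<gamma> X q X0\<close> says that \<open>X\<close> is written as \<open>q X0\<close> with \<open>q\<close> invertible of degree
  \<open>\<gamma>\<close> and \<open>X0\<close> of degree \<open>0\<close>.\<close>

definition factorization ::
  "nat \<Rightarrow> (degree \<Rightarrow> 'a::ring_1 set) \<Rightarrow> nat list \<Rightarrow> degree \<Rightarrow> 'a mat \<Rightarrow> 'a \<Rightarrow> 'a mat \<Rightarrow> bool" where
  "factorization n A r \<gamma> X q X0 \<longleftrightarrow>
     q \<in> A \<gamma> \<and> invertible_elem q \<and> X0 \<in> graded_mats n A r (deg_zero n) \<and>
     X = graded_smult n r \<gamma> q X0"

definition gdet ::
  "('k \<Rightarrow> 'a::ring_1 \<Rightarrow> 'a) \<Rightarrow> nat \<Rightarrow> (degree \<Rightarrow> 'a set) \<Rightarrow> nat list \<Rightarrow> 'a mat \<Rightarrow> 'a" where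
  "gdet scale n A r X = (THE d. \<exists>\<gamma>\<in>Even_degs n. \<exists>q X0.
     factorization n A r \<gamma> X q X0 \<and> d = q ^ sum_list r * gdet0 scale n A r X0)"

definition gdet_multiplicative ::
  "('k \<Rightarrow> 'a::ring_1 \<Rightarrow> 'a) \<Rightarrow> nat \<Rightarrow> (degree \<Rightarrow> 'a set) \<Rightarrow> nat list \<Rightarrow> bool" where
  "gdet_multiplicative scale n A r \<longleftrightarrow>
     (\<forall>\<gamma>\<in>Even_degs n. \<forall>\<delta>\<in>Even_degs n. \<forall>X\<in>graded_mats n A r \<gamma>. \<forall>Y\<in>graded_mats n A r \<delta>.
        gdet scale n A r (X * Y) = gdet scale n A r X * gdet scale n A r Y)"

end

theory Submission
  imports Defs "Jordan_Normal_Form.Determinant"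
begin

text \<open>
  Write \<open>N\<close> for the number of rows. Choose an invertible \<open>t i\<close> in the component of the degree
  \<open>\<rho> i\<close> of row \<open>i\<close>, with inverse \<open>s i\<close>. For a matrix \<open>X\<close> of degree zero, the matrix with entries
  \<open>s i * X $$ (i, j) * t j\<close> has entries of degree zero, which are central. The
  ordinary determinant of this matrix is the graded determinant (\<open>is_gdet0_det0\<close>). It is
  multiplicative because the passage is a conjugation. It has the right value on block diagonal and block unitriangular
  matrices because diagonal blocks are left unchanged, and the formula by quasideterminants becomes
  the Schur complement formula. It is a polynomial in the entries of \<open>X\<close> because in each Leibniz
  term the factors \<open>t\<close> and \<open>s\<close> cancel up to a sign that depends only on the permutation
  (\<open>untwisted_prod\<close>).

  It is the only such map (\<open>is_gdet0_unique\<close>). If \<open>X\<close> has entries \<open>t i * c i j * s j\<close> with integers \<open>c i j\<close>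
  forming a matrix that is the identity modulo \<open>2\<close>, then all tails of \<open>X\<close> are invertible and
  the formula by quasideterminants leaves no choice. Each entry varies here independently in an infinite set, and the
  difference of two candidates is a polynomial in the entries, so vanishing on these matrices
  forces vanishing everywhere (\<open>entry_polynomial_zero\<close>).

  For matrices \<open>q X0\<close> and \<open>p Y0\<close> of degrees \<open>\<gamma>\<close> and \<open>\<delta>\<close> the product is \<open>(q p) (X0 Y0)\<close>, and
  \<open>(q p) ^ N\<close> equals \<open>q ^ N * p ^ N\<close> up to the sign of \<open>\<gamma>\<close> and \<open>\<delta>\<close> to the power \<open>N * (N - 1) / 2\<close>
  (\<open>gdet_mult\<close>). This exponent is even exactly if \<open>N\<close> is \<open>0\<close> or \<open>1\<close> modulo \<open>4\<close>. Otherwise the sign survives as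
  soon as two even degrees have scalar product \<open>1\<close>. Such degrees exist for
  \<open>n \<ge> 3\<close>; for \<open>n \<le> 2\<close> there are none.
\<close>

section \<open>Determinants of block triangular matrices over a commutative ring\<close>

text \<open>The degree zero component of the algebra may have zero divisors, so the determinant formulas for
  block triangular matrices are needed over arbitrary commutative rings. A block triangular matrix is
  a product of two matrices each having an identity block, and an identity block is removed one row
  at a time by Laplace expansion.\<close>

lemma det_four_block_lower_identity:
  fixes A :: "'a::comm_ring_1 mat"
  assumes A: "A \<in> carrier_mat n n" and B: "B \<in> carrier_mat n m"
  shows "det (four_block_mat A B (0\<^sub>m m n) (1\<^sub>m m)) = det A"
  using B
proof (induction m arbitrary: B)
  case 0
  have "four_block_mat A B (0\<^sub>m 0 n) (1\<^sub>m 0) = A"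
    by (rule eq_matI) (use A 0 in auto)
  then show ?case by simp
next
  case (Suc m)
  define B' where "B' = mat n m (\<lambda>ij. B $$ ij)"
  let ?M = "four_block_mat A B (0\<^sub>m (Suc m) n) (1\<^sub>m (Suc m))"
  have M: "?M \<in> carrier_mat (n + Suc m) (n + Suc m)" using A by auto
  have last_row: "?M $$ (n + m, j) = (if j = n + m then 1 else 0)" if "j < n + Suc m" for j
    using that A Suc.prems by auto
  have del: "mat_delete ?M (n + m) (n + m) = four_block_mat A B' (0\<^sub>m m n) (1\<^sub>m m)"
    by (rule eq_matI) (use A Suc.prems in \<open>auto simp: mat_delete_def B'_def\<close>)
  have "det ?M = (\<Sum>j<n + Suc m. ?M $$ (n + m, j) * cofactor ?M (n + m) j)"
    by (rule laplace_expansion_row[OF M]) simp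
  also have "\<dots> = (\<Sum>j<n + Suc m. if j = n + m then cofactor ?M (n + m) (n + m) else 0)"
    by (rule sum.cong) (auto simp: last_row simp del: index_mat_four_block)
  also have "\<dots> = det (mat_delete ?M (n + m) (n + m))"
    by (simp add: cofactor_def power_add[symmetric] mult_2[symmetric])
  also have "\<dots> = det A"
    unfolding del by (rule Suc.IH) (simp add: B'_def)
  finally show ?case .
qed

lemma det_four_block_upper_identity:
  fixes D :: "'a::comm_ring_1 mat"
  assumes D: "D \<in> carrier_mat m m"
  shows "det (four_block_mat (1\<^sub>m n) (0\<^sub>m n m) (0\<^sub>m m n) D) = det D"
proof (induction n)
  case 0
  have "four_block_mat (1\<^sub>m 0) (0\<^sub>m 0 m) (0\<^sub>m m 0) D = D"
    by (rule eq_matI) (use D in auto)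
  then show ?case by simp
next
  case (Suc n)
  let ?M = "four_block_mat (1\<^sub>m (Suc n)) (0\<^sub>m (Suc n) m) (0\<^sub>m m (Suc n)) D"
  have M: "?M \<in> carrier_mat (Suc n + m) (Suc n + m)" using D by auto
  have first_row: "?M $$ (0, j) = (if j = 0 then 1 else 0)" if "j < Suc n + m" for j
    using that D by auto
  have del: "mat_delete ?M 0 0 = four_block_mat (1\<^sub>m n) (0\<^sub>m n m) (0\<^sub>m m n) D"
    by (rule eq_matI) (use D in \<open>auto simp: mat_delete_def\<close>)
  have "det ?M = (\<Sum>j<Suc n + m. ?M $$ (0, j) * cofactor ?M 0 j)"
    by (rule laplace_expansion_row[OF M]) simp
  also have "\<dots> = (\<Sum>j<Suc n + m. if j = 0 then cofactor ?M 0 0 else 0)"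
    by (rule sum.cong) (auto simp: first_row simp del: index_mat_four_block)
  also have "\<dots> = det (mat_delete ?M 0 0)"
    by (simp add: cofactor_def)
  also have "\<dots> = det D"
    unfolding del by (rule Suc.IH)
  finally show ?case .
qed

lemma det_block_upper_triangular:
  fixes A :: "'a::comm_ring_1 mat"
  assumes A: "A \<in> carrier_mat n n" and B: "B \<in> carrier_mat n m" and D: "D \<in> carrier_mat m m"
  shows "det (four_block_mat A B (0\<^sub>m m n) D) = det A * det D"
proof -
  have "four_block_mat A B (0\<^sub>m m n) D =
    four_block_mat (1\<^sub>m n) (0\<^sub>m n m) (0\<^sub>m m n) D * four_block_mat A B (0\<^sub>m m n) (1\<^sub>m m)"
    by (subst mult_four_block_mat[of _ n n _ m _ m _ _ n _ m]) (use A B D in auto)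
  also have "det \<dots> = det D * det A"
    by (subst det_mult[of _ "n + m"])
      (use A B D in \<open>simp_all add: det_four_block_lower_identity det_four_block_upper_identity\<close>)
  finally show ?thesis by (simp add: mult.commute)
qed

lemma det_block_lower_triangular:
  fixes A :: "'a::comm_ring_1 mat"
  assumes A: "A \<in> carrier_mat n n" and C: "C \<in> carrier_mat m n" and D: "D \<in> carrier_mat m m"
  shows "det (four_block_mat A (0\<^sub>m n m) C D) = det A * det D"
proof -
  let ?M = "four_block_mat A (0\<^sub>m n m) C D"
  have "det ?M = det (transpose_mat ?M)"
    using A D by (subst det_transpose[of _ "n + m"]) auto
  also have "transpose_mat ?M
      = four_block_mat (transpose_mat A) (transpose_mat C) (0\<^sub>m m n) (transpose_mat D)"
    by (subst transpose_four_block_mat[of _ n n _ m _ m]) (use A C D in auto)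
  also have "det \<dots> = det A * det D"
    by (subst det_block_upper_triangular[of _ n _ m]) (use A C D in \<open>auto simp: det_transpose\<close>)
  finally show ?thesis .
qed

text \<open>Right multiplication by the block unitriangular matrix with lower left block \<open>- Z * C\<close> clears the
  lower left block of the matrix and leaves the Schur complement in the upper left one.\<close>

lemma det_schur_complement:
  fixes A :: "'a::comm_ring_1 mat"
  assumes A: "A \<in> carrier_mat n n" and B: "B \<in> carrier_mat n m" and C: "C \<in> carrier_mat m n"
    and D: "D \<in> carrier_mat m m" and Z: "Z \<in> carrier_mat m m" and DZ: "D * Z = 1\<^sub>m m"
  shows "det (four_block_mat A B C D) = det (A - B * Z * C) * det D"
proof -
  let ?E = "four_block_mat (1\<^sub>m n) (0\<^sub>m n m) (- (Z * C)) (1\<^sub>m m)"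
  have BZC: "B * Z * C \<in> carrier_mat n n" using B Z C by auto
  have "A + B * - (Z * C) = A - B * Z * C"
  proof -
    have "B * - (Z * C) = - (B * Z * C)" using B Z C by (simp add: assoc_mult_mat[of _ n m _ m _ n])
    then show ?thesis using A BZC by (auto simp: minus_add_uminus_mat)
  qed
  moreover have "C + D * - (Z * C) = 0\<^sub>m m n"
  proof -
    have "D * - (Z * C) = - (D * Z * C)" using D Z C by (simp add: assoc_mult_mat[of _ m m _ m _ n])
    then show ?thesis using C by (simp add: DZ) (rule eq_matI, auto)
  qed
  ultimately have "four_block_mat A B C D * ?E = four_block_mat (A - B * Z * C) B (0\<^sub>m m n) D"
    by (subst mult_four_block_mat[of _ n n _ m _ m _ _ n _ m]) (use A B C D Z in auto)
  then have "det (four_block_mat A B C D) * det ?E = det (A - B * Z * C) * det D"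
    using A B C D Z BZC
    by (metis det_mult det_block_upper_triangular four_block_carrier_mat minus_carrier_mat one_carrier_mat)
  moreover have "det ?E = 1"
    by (subst det_block_lower_triangular) (use C Z in auto)
  ultimately show ?thesis by simp
qed

section \<open>Block structure and the determinant as a product over the diagonal blocks\<close>

lemma offset_Suc: "k < length r \<Longrightarrow> offset r (Suc k) = offset r k + r ! k"
  by (simp add: offset_def take_Suc_conv_app_nth)

lemma offset_le: "offset r k \<le> sum_list r"
  by (metis append_take_drop_id le_add1 offset_def sum_list_append)

lemma offset_mono: "k \<le> l \<Longrightarrow> offset r k \<le> offset r l"
  by (metis offset_le offset_def min.absorb1 take_take)

lemma offset_0: "offset r 0 = 0"
  by (simp add: offset_def)

lemma offset_length: "offset r (length r) = sum_list r"
  by (simp add: offset_def)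

lemma block_of_eqI:
  assumes "offset r k \<le> i" "i < offset r (Suc k)"
  shows "block_of r i = k"
  unfolding block_of_def
proof (rule Least_equality)
  fix l assume l: "i < offset r (Suc l)"
  show "k \<le> l"
  proof (rule ccontr)
    assume "\<not> k \<le> l"
    then have "offset r (Suc l) \<le> offset r k" by (intro offset_mono) simp
    with l assms show False by simp
  qed
qed (rule assms(2))

lemma
  assumes "i < sum_list r"
  shows block_of_less_length: "block_of r i < length r"
    and less_offset_Suc_block_of: "i < offset r (Suc (block_of r i))"
proof -
  have ex: "\<exists>k. i < offset r (Suc k)"
    using assms by (intro exI[of _ "length r"]) (simp add: offset_def)
  from LeastI_ex[OF ex] show less: "i < offset r (Suc (block_of r i))"
    unfolding block_of_def .
  have le: "offset r (block_of r i) \<le> i"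
  proof (cases "block_of r i")
    case 0 then show ?thesis by (simp add: offset_0)
  next
    case (Suc k)
    then have "\<not> i < offset r (Suc k)"
      unfolding block_of_def by (metis lessI not_less_Least)
    with Suc show ?thesis by simp
  qed
  show "block_of r i < length r"
  proof (rule ccontr)
    assume "\<not> ?thesis"
    then have "offset r (block_of r i) = sum_list r" by (simp add: offset_def)
    with le assms show False by simp
  qed
qed

lemma window_carrier [simp]: "window X i h j w \<in> carrier_mat h w"
  by (simp add: window_def)

lemma window_index [simp]: "a < h \<Longrightarrow> b < w \<Longrightarrow> window X i h j w $$ (a, b) = X $$ (i + a, j + b)"
  by (simp add: window_def)

lemma window_dim [simp]: "dim_row (window X i h j w) = h" "dim_col (window X i h j w) = w"
  by (simp_all add: window_def)

lemma tail_carrier: "tail r X k \<in> carrier_mat (sum_list r - offset r k) (sum_list r - offset r k)"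
  by (simp add: tail_def Let_def)

lemma block_carrier: "block r X k l \<in> carrier_mat (r ! k) (r ! l)"
  by (simp add: block_def)

lemma tail_0: "X \<in> carrier_mat (sum_list r) (sum_list r) \<Longrightarrow> tail r X 0 = X"
  by (rule eq_matI) (auto simp: tail_def offset_0 Let_def)

lemma tail_four_block:
  assumes k: "k < length r"
  defines "o1 \<equiv> offset r k" and "o2 \<equiv> offset r (Suc k)"
  defines "t \<equiv> sum_list r - o2"
  shows "tail r X k = four_block_mat (block r X k k) (window X o1 (r ! k) o2 t)
           (window X o2 t o1 (r ! k)) (tail r X (Suc k))"
proof -
  have o2: "o2 = o1 + r ! k" and "o2 \<le> sum_list r"
    using offset_Suc[OF k] offset_le[of r "Suc k"] by (auto simp: o1_def o2_def)
  then have "sum_list r - o1 = r ! k + t" by (simp add: t_def)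
  then show ?thesis
    by (intro eq_matI) (auto simp: tail_def block_def Let_def o2 simp flip: o1_def o2_def t_def)
qed

text \<open>Both the product formula for block triangular matrices and the one by quasideterminants peel off
  one diagonal block at a time, starting from the upper left corner. This is the common induction.\<close>

lemma det_eq_prod_of_tail_step:
  fixes X :: "'a::comm_ring_1 mat"
  assumes X: "X \<in> carrier_mat (sum_list r) (sum_list r)"
    and step: "\<And>k. k < length r \<Longrightarrow> det (tail r X k) = f k * det (tail r X (Suc k))"
  shows "det X = prod_list (map f [0..<length r])"
proof -
  have "det X = prod_list (map f [0..<k]) * det (tail r X k)" if "k \<le> length r" for k
    using that
  proof (induction k)
    case 0 then show ?case by (simp add: tail_0[OF X])
  next
    case (Suc k) then show ?case by (simp add: step mult.assoc)
  qed
  from this[of "length r"] show ?thesis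
    using tail_carrier[of r X "length r"] by (simp add: offset_length)
qed

lemma det_block_triangular:
  fixes X :: "'a::comm_ring_1 mat"
  assumes X: "X \<in> carrier_mat (sum_list r) (sum_list r)"
    and tri: "block_upper_triangular r X \<or> block_lower_triangular r X"
  shows "det X = prod_list (map (\<lambda>k. det (block r X k k)) [0..<length r])"
proof (rule det_eq_prod_of_tail_step[OF X])
  fix k assume k: "k < length r"
  define o1 o2 t where "o1 = offset r k" and "o2 = offset r (Suc k)" and "t = sum_list r - o2"
  note split = tail_four_block[OF k, of X, folded o1_def o2_def, folded t_def]
  have o2: "o2 = o1 + r ! k" and o2_le: "o2 \<le> sum_list r"
    using offset_Suc[OF k] offset_le[of r "Suc k"] by (auto simp: o1_def o2_def)
  have head: "block_of r (o1 + a) = k" if "a < r ! k" for a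
    using that o2 by (intro block_of_eqI) (auto simp: o1_def o2_def)
  have rest: "k < block_of r (o2 + b)" if "b < t" for b
  proof (rule ccontr)
    assume "\<not> ?thesis"
    then have "offset r (Suc (block_of r (o2 + b))) \<le> o2"
      unfolding o2_def by (intro offset_mono) simp
    moreover have "o2 + b < offset r (Suc (block_of r (o2 + b)))"
      using that by (intro less_offset_Suc_block_of) (simp add: t_def)
    ultimately show False by simp
  qed
  have T: "tail r X (Suc k) \<in> carrier_mat t t"
    using tail_carrier[of r X "Suc k"] by (simp add: t_def o2_def)
  from tri show "det (tail r X k) = det (block r X k k) * det (tail r X (Suc k))"
  proof
    assume up: "block_upper_triangular r X"
    have "window X o2 t o1 (r ! k) = 0\<^sub>m t (r ! k)"
      using up o2 o2_le head rest
      by (intro eq_matI) (auto simp: block_upper_triangular_def t_def)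
    then show ?thesis
      unfolding split by (simp add: det_block_upper_triangular[OF block_carrier _ T])
  next
    assume low: "block_lower_triangular r X"
    have "window X o1 (r ! k) o2 t = 0\<^sub>m (r ! k) t"
      using low o2 o2_le head rest
      by (intro eq_matI) (auto simp: block_lower_triangular_def t_def)
    then show ?thesis
      unfolding split by (simp add: det_block_lower_triangular[OF block_carrier _ T])
  qed
qed

text \<open>Over a commutative ring the quasideterminant at the upper left block of a tail is the Schur
  complement of the next tail, so the product formula is the iterated Schur complement formula.\<close>

lemma det_eq_prod_quasidet:
  fixes X :: "'a::comm_ring_1 mat"
  assumes X: "X \<in> carrier_mat (sum_list r) (sum_list r)"
    and Z: "\<And>k. k < length r \<Longrightarrow> mat_inverse_of (tail r X (Suc k)) (Z k)"
  shows "det X = prod_list (map (\<lambda>k. det (quasidet r X k (Z k))) [0..<length r])"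
proof (rule det_eq_prod_of_tail_step[OF X])
  fix k assume k: "k < length r"
  have T: "tail r X (Suc k) \<in> carrier_mat (sum_list r - offset r (Suc k)) (sum_list r - offset r (Suc k))"
    by (rule tail_carrier)
  show "det (tail r X k) = det (quasidet r X k (Z k)) * det (tail r X (Suc k))"
    unfolding tail_four_block[OF k] quasidet_def Let_def
    by (rule det_schur_complement[OF block_carrier _ _ T])
      (use Z[OF k] T in \<open>auto simp: mat_inverse_of_def inverts_mat_def\<close>)
qed


section \<open>The center of a ring as a commutative ring\<close>

text \<open>Elements of degree zero commute with all elements. Determinants are taken over
  commutative ring types, and the center is such a type for every ring, whereas the degree zero
  component depends on the grading and is not a type.\<close>

typedef (overloaded) 'a center = "{x :: 'a::ring_1. \<forall>y. x * y = y * x}"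
  morphisms of_center to_center
  by (rule exI[of _ 0]) simp

setup_lifting type_definition_center

instantiation center :: (ring_1) comm_ring_1
begin
lift_definition zero_center :: "'a center" is 0 by simp
lift_definition one_center :: "'a center" is 1 by simp
lift_definition plus_center :: "'a center \<Rightarrow> 'a center \<Rightarrow> 'a center" is "(+)"
  by (simp add: distrib_left distrib_right)
lift_definition minus_center :: "'a center \<Rightarrow> 'a center \<Rightarrow> 'a center" is "(-)"
  by (simp add: left_diff_distrib right_diff_distrib)
lift_definition uminus_center :: "'a center \<Rightarrow> 'a center" is "uminus"
  by simp
lift_definition times_center :: "'a center \<Rightarrow> 'a center \<Rightarrow> 'a center" is "(*)"
  by (metis mult.assoc)
instance
proof
  fix a b c :: "'a center"
  show "a * b * c = a * (b * c)" by transfer (rule mult.assoc)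
  show "a * b = b * a" by transfer blast
  show "1 * a = a" by transfer (rule mult_1_left)
  show "a + b + c = a + (b + c)" by transfer (rule add.assoc)
  show "a + b = b + a" by transfer (rule add.commute)
  show "0 + a = a" by transfer (rule add_0_left)
  show "- a + a = 0" by transfer (rule left_minus)
  show "a - b = a + - b" by transfer (rule diff_conv_add_uminus)
  show "(a + b) * c = a * c + b * c" by transfer (rule distrib_right)
  show "(0 :: 'a center) \<noteq> 1" by transfer (rule zero_neq_one)
qed
end

definition central :: "'a::ring_1 \<Rightarrow> bool" where
  "central x \<longleftrightarrow> (\<forall>y. x * y = y * x)"

lemma central_of_int [simp]: "central (of_int m :: 'a::ring_1)"
  by (simp add: central_def mult_of_int_commute)

lemma centralD: "central x \<Longrightarrow> x * y = y * x"
  by (simp add: central_def)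

lemma central_of_center [simp]: "central (of_center c)"
  using of_center[of c] by (simp add: central_def)

lemma of_center_to_center: "central x \<Longrightarrow> of_center (to_center x) = x"
  by (simp add: central_def to_center_inverse)

interpretation of_center: ring_hom "of_center :: 'a::ring_1 center \<Rightarrow> 'a"
proof
  fix x y :: "'a center"
  show "of_center (x + y) = of_center x + of_center y" by (rule plus_center.rep_eq)
  show "of_center (x * y) = of_center x * of_center y" by (rule times_center.rep_eq)
qed (rule zero_center.rep_eq one_center.rep_eq)+

lemma of_center_prod:
  "of_center (prod f {0..<n}) = prod_list (map (\<lambda>i. of_center (f i)) [0..<n])"
proof -
  have "prod f {0..<n} = prod_list (map f [0..<n])"
    by (metis atLeastLessThan_upt distinct_upt prod.distinct_set_conv_list)
  also have "of_center \<dots> = prod_list (map (\<lambda>i. of_center (f i)) [0..<n])"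
    by (induction n) (auto simp: of_center.hom_mult)
  finally show ?thesis .
qed

lemma leibniz_det_of_center:
  assumes "C \<in> carrier_mat m m"
  shows "leibniz_det (map_mat of_center C) = of_center (det C)"
proof -
  have "of_center (det C) = (\<Sum>p | p permutes {0..<m}.
      of_center (signof p * (\<Prod>i = 0..<m. C $$ (i, p i))))"
    by (simp add: det_def'[OF assms] of_center.hom_sum)
  also have "\<dots> = leibniz_det (map_mat of_center C)"
    unfolding leibniz_det_def
  proof (rule sum.cong)
    fix p assume "p \<in> {p. p permutes {0..<dim_row (map_mat of_center C)}}"
    then have p: "p permutes {0..<m}" using assms by simp
    then have "prod_list (map (\<lambda>i. of_center (C $$ (i, p i))) [0..<m])
        = prod_list (map (\<lambda>i. map_mat of_center C $$ (i, p i)) [0..<m])"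
      using assms permutes_in_image[OF p]
      by (intro arg_cong[where f = prod_list] map_cong) auto
    then show "of_center (signof p * (\<Prod>i = 0..<m. C $$ (i, p i))) =
      of_int (sign p) * prod_list (map (\<lambda>i. map_mat of_center C $$ (i, p i))
        [0..<dim_row (map_mat of_center C)])"
      using assms by (simp add: of_center.hom_mult of_center_prod)
  qed (use assms in auto)
  finally show ?thesis by simp
qed

definition central_mat :: "'a::ring_1 mat \<Rightarrow> bool" where
  "central_mat M \<longleftrightarrow> (\<forall>a<dim_row M. \<forall>b<dim_col M. central (M $$ (a, b)))"

lemma of_center_to_center_mat:
  "central_mat M \<Longrightarrow> map_mat of_center (map_mat to_center M) = M"
  by (rule eq_matI) (auto simp: central_mat_def of_center_to_center)

text \<open>If \<open>M\<close> is invertible and commutes with all scalar matrices, then so does its inverse. This puts the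
  inverses of tails, which are only given over the noncommutative algebra, back into the center.\<close>

lemma central_mat_inverse:
  fixes M :: "'a::ring_1 mat"
  assumes M: "M \<in> carrier_mat m m" "central_mat M" and Z: "mat_inverse_of M Z"
  shows "central_mat Z"
proof -
  from Z M have Zc: "Z \<in> carrier_mat m m" and MZ: "M * Z = 1\<^sub>m m" and ZM: "Z * M = 1\<^sub>m m"
    by (auto simp: mat_inverse_of_def inverts_mat_def)
  have "Z $$ (a, b) * y = y * Z $$ (a, b)" if ab: "a < m" "b < m" for a b y
  proof -
    define Y where "Y = y \<cdot>\<^sub>m (1\<^sub>m m)"
    have Y: "Y \<in> carrier_mat m m" by (simp add: Y_def)
    have left: "(Y * N) $$ (i, j) = y * N $$ (i, j)"
      and right: "(N * Y) $$ (i, j) = N $$ (i, j) * y"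
      if "N \<in> carrier_mat m m" "i < m" "j < m" for N i j
    proof -
      have "(Y * N) $$ (i, j) = (\<Sum>k\<in>{0..<m}. Y $$ (i, k) * N $$ (k, j))"
        using that Y by (simp add: scalar_prod_def)
      also have "\<dots> = (\<Sum>k\<in>{0..<m}. if i = k then y * N $$ (k, j) else 0)"
        by (rule sum.cong) (use that in \<open>auto simp: Y_def\<close>)
      finally show "(Y * N) $$ (i, j) = y * N $$ (i, j)" using that by simp
      have "(N * Y) $$ (i, j) = (\<Sum>k\<in>{0..<m}. N $$ (i, k) * Y $$ (k, j))"
        using that Y by (simp add: scalar_prod_def)
      also have "\<dots> = (\<Sum>k\<in>{0..<m}. if k = j then N $$ (i, k) * y else 0)"
        by (rule sum.cong) (use that in \<open>auto simp: Y_def\<close>)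
      finally show "(N * Y) $$ (i, j) = N $$ (i, j) * y" using that by simp
    qed
    have YM: "Y * M = M * Y"
      using M Y by (intro eq_matI) (auto simp: left right central_mat_def central_def
        simp del: index_mult_mat(1))
    have "Z * Y = Z * (Y * (M * Z))" using Zc Y by (simp add: MZ)
    also have "\<dots> = Z * (Y * M) * Z" using Zc Y M by (simp add: assoc_mult_mat[of _ m m _ m _ m])
    also have "\<dots> = Z * M * (Y * Z)"
      unfolding YM using Zc Y M by (simp add: assoc_mult_mat[of _ m m _ m _ m])
    also have "\<dots> = Y * Z" using Zc Y by (simp add: ZM)
    finally show ?thesis using left[OF Zc ab] right[OF Zc ab] by simp
  qed
  with Zc show ?thesis by (auto simp: central_mat_def central_def)
qed

lemma map_mat_of_center_inj:
  assumes "map_mat of_center M = map_mat of_center M'"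
  shows "M = M'"
proof (rule eq_matI)
  from assms have "dim_row (map_mat of_center M) = dim_row (map_mat of_center M')"
    "dim_col (map_mat of_center M) = dim_col (map_mat of_center M')" by simp_all
  then show d: "dim_row M = dim_row M'" "dim_col M = dim_col M'" by simp_all
  fix i j assume "i < dim_row M'" "j < dim_col M'"
  then show "M $$ (i, j) = M' $$ (i, j)"
    using assms d by (metis index_map_mat(1) of_center_inject)
qed

lemma mat_inverse_of_map_of_center:
  assumes "M \<in> carrier_mat m m" "Z \<in> carrier_mat m m"
    and "mat_inverse_of (map_mat of_center M) (map_mat of_center Z)"
  shows "mat_inverse_of M Z"
proof -
  have "map_mat of_center (M * Z) = map_mat of_center (1\<^sub>m m)"
    "map_mat of_center (Z * M) = map_mat of_center (1\<^sub>m m)"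
    using assms
    by (simp_all add: of_center.mat_hom_mult[of _ m m] of_center.mat_hom_one
        mat_inverse_of_def inverts_mat_def)
  then show ?thesis
    using assms by (auto simp: mat_inverse_of_def inverts_mat_def dest: map_mat_of_center_inj)
qed

section \<open>Rescaling rows and columns\<close>

text \<open>Multiplication by a diagonal matrix on either side. Rows are rescaled from the left and columns
  from the right; the order matters because the scaling factors need not be central.\<close>

definition twist :: "(nat \<Rightarrow> 'a::ring_1) \<Rightarrow> (nat \<Rightarrow> 'a) \<Rightarrow> 'a mat \<Rightarrow> 'a mat" where
  "twist u v M = mat (dim_row M) (dim_col M) (\<lambda>(a, b). u a * M $$ (a, b) * v b)"

lemma twist_carrier [simp]: "M \<in> carrier_mat m l \<Longrightarrow> twist u v M \<in> carrier_mat m l"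
  unfolding twist_def by auto

lemma twist_index [simp]:
  "a < dim_row M \<Longrightarrow> b < dim_col M \<Longrightarrow> twist u v M $$ (a, b) = u a * M $$ (a, b) * v b"
  by (simp add: twist_def)

lemma twist_dim [simp]: "dim_row (twist u v M) = dim_row M" "dim_col (twist u v M) = dim_col M"
  by (simp_all add: twist_def)

lemma twist_mult:
  assumes M: "M \<in> carrier_mat m l" and N: "N \<in> carrier_mat l h"
    and inv: "\<And>b. b < l \<Longrightarrow> v b * u' b = 1"
  shows "twist u v M * twist u' w N = twist u w (M * N)"
proof (rule eq_matI)
  fix i j assume "i < dim_row (twist u w (M * N))" "j < dim_col (twist u w (M * N))"
  then have ij: "i < m" "j < h" using M N by simp_all
  have "u i * M $$ (i, b) * v b * (u' b * N $$ (b, j) * w j) = u i * (M $$ (i, b) * N $$ (b, j)) * w j"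
    if "b < l" for b
  proof -
    have "u i * M $$ (i, b) * v b * (u' b * N $$ (b, j) * w j)
        = u i * M $$ (i, b) * (v b * u' b) * N $$ (b, j) * w j"
      by (simp only: mult.assoc)
    then show ?thesis by (simp add: inv[OF that] mult.assoc)
  qed
  then show "(twist u v M * twist u' w N) $$ (i, j) = twist u w (M * N) $$ (i, j)"
    using M N ij by (simp add: scalar_prod_def sum_distrib_left sum_distrib_right)
qed (use M N in auto)

lemma twist_minus:
  assumes "M \<in> carrier_mat m l" "N \<in> carrier_mat m l"
  shows "twist u v (M - N) = twist u v M - twist u v N"
  by (rule eq_matI) (use assms in \<open>auto simp: algebra_simps\<close>)

lemma twist_one:
  assumes "\<And>a. a < m \<Longrightarrow> u a * v a = 1"
  shows "twist u v (1\<^sub>m m) = 1\<^sub>m m"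
  by (rule eq_matI) (use assms in auto)

lemma mat_inverse_of_twist:
  assumes M: "M \<in> carrier_mat m m" and Z: "mat_inverse_of M Z"
    and vu: "\<And>b. b < m \<Longrightarrow> v b * u b = 1" "\<And>b. b < m \<Longrightarrow> u b * v b = 1"
  shows "mat_inverse_of (twist u v M) (twist u v Z)"
proof -
  have Zc: "Z \<in> carrier_mat m m" and MZ: "M * Z = 1\<^sub>m m" "Z * M = 1\<^sub>m m"
    using M Z by (auto simp: mat_inverse_of_def inverts_mat_def)
  show ?thesis
    using M Zc vu
    by (simp add: mat_inverse_of_def inverts_mat_def twist_mult[OF M Zc] twist_mult[OF Zc M]
      twist_one MZ carrier_matD[OF M] carrier_matD[OF Zc])
qed

lemma twist_window:
  assumes "M \<in> carrier_mat m l" "i + h \<le> m" "j + w \<le> l"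
  shows "window (twist u v M) i h j w = twist (\<lambda>a. u (i + a)) (\<lambda>b. v (j + b)) (window M i h j w)"
  by (rule eq_matI) (use assms in auto)

section \<open>Polynomial functions of one central variable\<close>

definition center_polynomial :: "('a::ring_1 \<Rightarrow> 'a) \<Rightarrow> bool" where
  "center_polynomial f \<longleftrightarrow> (\<exists>m a. \<forall>x. central x \<longrightarrow> f x = (\<Sum>e<m. a e * x ^ e))"

lemma center_polynomial_const: "center_polynomial (\<lambda>x. c)"
  unfolding center_polynomial_def by (intro exI[of _ 1] exI[of _ "\<lambda>_. c"]) simp

lemma center_polynomial_add:
  assumes "center_polynomial f" "center_polynomial g"
  shows "center_polynomial (\<lambda>x. f x + g x)"
proof -
  from assms obtain m a m' b where
    f: "\<And>x. central x \<Longrightarrow> f x = (\<Sum>e<m. a e * x ^ e)" and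
    g: "\<And>x. central x \<Longrightarrow> g x = (\<Sum>e<m'. b e * x ^ e)"
    unfolding center_polynomial_def by auto
  define c where "c e = (if e < m then a e else 0) + (if e < m' then b e else 0)" for e
  have pad: "(\<Sum>e<m. a e * x ^ e) = (\<Sum>e<m + k. (if e < m then a e else 0) * x ^ e)"
    for m k a and x :: 'a
    by (induction k) auto
  have "f x + g x = (\<Sum>e<m + m'. c e * x ^ e)" if "central x" for x
    unfolding f[OF that] g[OF that] pad[of a x m m'] pad[of b x m' m] c_def
    by (simp add: sum.distrib algebra_simps)
  then show ?thesis unfolding center_polynomial_def by blast
qed

lemma center_polynomial_cmult:
  assumes "center_polynomial f"
  shows "center_polynomial (\<lambda>x. c * f x)"
proof -
  from assms obtain m a where f: "\<And>x. central x \<Longrightarrow> f x = (\<Sum>e<m. a e * x ^ e)"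
    unfolding center_polynomial_def by auto
  show ?thesis unfolding center_polynomial_def
    by (intro exI[of _ m] exI[of _ "\<lambda>e. c * a e"]) (auto simp: f sum_distrib_left mult.assoc)
qed

text \<open>Centrality of the variable is what allows it to be moved past the coefficients.\<close>

lemma center_polynomial_shift:
  assumes "center_polynomial f"
  shows "center_polynomial (\<lambda>x. x * f x)"
proof -
  from assms obtain m a where f: "\<And>x. central x \<Longrightarrow> f x = (\<Sum>e<m. a e * x ^ e)"
    unfolding center_polynomial_def by auto
  define b where "b e = (case e of 0 \<Rightarrow> 0 | Suc e' \<Rightarrow> a e')" for e
  have "x * f x = (\<Sum>e<Suc m. b e * x ^ e)" if x: "central x" for x
  proof -
    have "x * (a e * x ^ e) = a e * (x * x ^ e)" for e
      by (metis centralD[OF x] mult.assoc)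
    then show ?thesis
      unfolding f[OF x] sum.lessThan_Suc_shift by (simp add: b_def sum_distrib_left)
  qed
  then show ?thesis unfolding center_polynomial_def by blast
qed

lemma center_polynomial_sum:
  assumes "\<And>e. e < (m::nat) \<Longrightarrow> center_polynomial (f e)"
  shows "center_polynomial (\<lambda>x. \<Sum>e<m. f e x)"
  using assms by (induction m) (auto intro: center_polynomial_const center_polynomial_add)

lemma center_polynomial_mult:
  assumes "center_polynomial f" "center_polynomial g"
  shows "center_polynomial (\<lambda>x. f x * g x)"
proof -
  from assms obtain m a where f: "\<And>x. central x \<Longrightarrow> f x = (\<Sum>e<m. a e * x ^ e)"
    unfolding center_polynomial_def by auto
  have shifts: "center_polynomial (\<lambda>x. x ^ e * g x)" for e
    by (induction e) (auto simp: assms(2) mult.assoc intro: center_polynomial_shift)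
  have "center_polynomial (\<lambda>x. \<Sum>e<m. a e * (x ^ e * g x))"
    by (intro center_polynomial_sum center_polynomial_cmult shifts)
  then show ?thesis
    unfolding center_polynomial_def by (auto simp: f sum_distrib_right mult.assoc)
qed

definition put_entry :: "'a mat \<Rightarrow> nat \<Rightarrow> nat \<Rightarrow> 'a \<Rightarrow> 'a mat" where
  "put_entry X i j e = mat (dim_row X) (dim_col X) (\<lambda>kl. if kl = (i, j) then e else X $$ kl)"

lemma put_entry_same: "put_entry X i j (X $$ (i, j)) = X"
  by (rule eq_matI) (auto simp: put_entry_def)

text \<open>An entry polynomial has no commutativity built in. It is nevertheless an ordinary polynomial function
  when only one entry varies and this entry is a central multiple of a fixed element.\<close>

lemma entry_polynomial_along_entry:
  assumes "entry_polynomial scale N p" and X: "X \<in> carrier_mat N N"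
  shows "center_polynomial (\<lambda>x. p (put_entry X i j (u * x * v)))"
  using assms(1)
proof induction
  case (const c)
  show ?case by (rule center_polynomial_const)
next
  case (entry k l)
  show ?case
  proof (cases "(k, l) = (i, j)")
    case True
    have "center_polynomial (\<lambda>x. u * (x * v))"
      by (intro center_polynomial_cmult center_polynomial_shift center_polynomial_const)
    then show ?thesis using True entry X by (simp add: put_entry_def mult.assoc)
  next
    case False
    then show ?thesis using entry X by (auto simp: put_entry_def intro: center_polynomial_const)
  qed
next
  case (add p p')
  then show ?case by (intro center_polynomial_add)
next
  case (mult p p')
  then show ?case by (intro center_polynomial_mult)
qed

context graded_comm_algebra
begin

lemma of_int_eq_scale: "of_int m = scale (of_int m) (1 :: 'a)"
proof -
  have nat: "of_nat k = scale (of_nat k) (1 :: 'a)" for k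
    by (induction k) (auto simp: scale_left_distrib)
  show ?thesis
    by (cases m rule: int_cases2) (simp_all add: nat)
qed

lemma scale_power_int: "a * of_int m ^ e = scale (of_int m ^ e) a"
proof (induction e)
  case (Suc e)
  have "a * of_int m ^ Suc e = a * of_int m ^ e * of_int m"
    by (metis mult.assoc power_Suc2)
  also have "\<dots> = scale (of_int m ^ e) a * scale (of_int m) 1"
    by (simp only: Suc.IH, simp only: of_int_eq_scale)
  also have "\<dots> = scale (of_int m) (scale (of_int m ^ e) a)"
    by (metis mult.right_neutral scale_mult_right)
  finally show ?case by simp
qed simp

text \<open>A polynomial function with infinitely many integral zeros vanishes, although its coefficients lie
  in an algebra that may have zero divisors: in coordinates with respect to a basis over the ground
  field it becomes a family of ordinary polynomials over a field of characteristic zero.\<close>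

lemma center_polynomial_zero:
  fixes f :: "'a \<Rightarrow> 'a"
  assumes f: "center_polynomial f" and S: "infinite S"
    and zero: "\<And>m. m \<in> S \<Longrightarrow> f (of_int m) = 0" and x: "central x"
  shows "f x = 0"
proof -
  from f obtain m a where f: "\<And>x. central x \<Longrightarrow> f x = (\<Sum>e<m. a e * x ^ e)"
    unfolding center_polynomial_def by auto
  define B where "B = extend_basis ({} :: 'a set)"
  have B: "independent B" and span: "y \<in> span B" for y
    unfolding B_def by (simp_all add: independent_empty independent_extend_basis span_extend_basis)
  have "representation B (a e) b = 0" if e: "e < m" for e b
  proof -
    define P where "P = (\<Sum>e<m. monom (representation B (a e) b) e)"
    have "poly P (of_int c) = 0" if "c \<in> S" for c
    proof -
      have "0 = representation B (\<Sum>e<m. a e * of_int c ^ e) b"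
        using f[of "of_int c"] zero[OF that] by (simp add: representation_zero)
      also have "\<dots> = (\<Sum>e<m. of_int c ^ e * representation B (a e) b)"
        by (simp add: scale_power_int representation_sum[OF B span] representation_scale[OF B span])
      finally show ?thesis
        by (simp add: P_def poly_sum poly_monom mult.commute)
    qed
    then have "of_int ` S \<subseteq> {c. poly P c = 0}" by auto
    moreover have "infinite (of_int ` S :: 'k set)"
      using S by (subst finite_image_iff) (auto intro: inj_onI)
    ultimately have "P = 0" using poly_roots_finite finite_subset by blast
    moreover have "coeff P e = representation B (a e) b"
      using e by (simp add: P_def coeff_sum)
    ultimately show ?thesis by simp
  qed
  then have "a e = 0" if "e < m" for e
    using sum_nonzero_representation_eq[OF B span, of "a e"] that by simp
  then show ?thesis by (simp add: f[OF x])
qed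

end


section \<open>Degrees and signs\<close>

lemma deg_add_commute: "\<gamma> \<oplus>\<^sub>d \<delta> = \<delta> \<oplus>\<^sub>d \<gamma>"
  unfolding deg_add_def
  by (induction \<gamma> \<delta> rule: list_induct2') (auto simp: add.commute)

lemma deg_add_assoc: "\<gamma> \<oplus>\<^sub>d \<delta> \<oplus>\<^sub>d \<epsilon> = \<gamma> \<oplus>\<^sub>d (\<delta> \<oplus>\<^sub>d \<epsilon>)"
proof (induction \<gamma> arbitrary: \<delta> \<epsilon>)
  case Nil then show ?case by (simp add: deg_add_def)
next
  case (Cons a \<gamma>)
  then show ?case by (cases \<delta>; cases \<epsilon>) (auto simp: deg_add_def add.assoc)
qed

lemma deg_add_left_commute: "\<gamma> \<oplus>\<^sub>d (\<delta> \<oplus>\<^sub>d \<epsilon>) = \<delta> \<oplus>\<^sub>d (\<gamma> \<oplus>\<^sub>d \<epsilon>)"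
  by (metis deg_add_assoc deg_add_commute)

lemma length_deg_add: "length (\<gamma> \<oplus>\<^sub>d \<delta>) = min (length \<gamma>) (length \<delta>)"
  by (simp add: deg_add_def)

lemma deg_add_zero_left: "length \<gamma> = n \<Longrightarrow> deg_zero n \<oplus>\<^sub>d \<gamma> = \<gamma>"
  by (induction n arbitrary: \<gamma>) (auto simp: deg_add_def deg_zero_def length_Suc_conv)

lemma deg_add_self: "\<gamma> \<oplus>\<^sub>d \<gamma> = deg_zero (length \<gamma>)"
  by (induction \<gamma>) (auto simp: deg_add_def deg_zero_def)

lemma sprod_commute: "sprod \<gamma> \<delta> = sprod \<delta> \<gamma>"
  unfolding sprod_def
  by (induction \<gamma> \<delta> rule: list_induct2') (auto simp: mult.commute)

lemma sprod_add_left: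
  assumes "length \<gamma> = length \<delta>"
  shows "sprod (\<gamma> \<oplus>\<^sub>d \<delta>) \<epsilon> = sprod \<gamma> \<epsilon> + sprod \<delta> \<epsilon>"
  using assms
proof (induction \<gamma> \<delta> arbitrary: \<epsilon> rule: list_induct2)
  case Nil then show ?case by (simp add: deg_add_def sprod_def)
next
  case (Cons a \<gamma> b \<delta>)
  then show ?case
    by (cases \<epsilon>) (auto simp: deg_add_def sprod_def distrib_right ac_simps)
qed

lemma sprod_zero_left: "sprod (deg_zero n) \<gamma> = 0"
proof (induction n arbitrary: \<gamma>)
  case 0 then show ?case by (simp add: deg_zero_def sprod_def)
next
  case (Suc n) then show ?case by (cases \<gamma>) (auto simp: deg_zero_def sprod_def)
qed

lemma Even_degs_iff: "\<gamma> \<in> Even_degs n \<longleftrightarrow> length \<gamma> = n \<and> sprod \<gamma> \<gamma> = 0"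
proof -
  have "list_all2 (\<lambda>x ys. x \<in> set ys) \<gamma> (replicate n [0, 1 :: bit]) \<longleftrightarrow> length \<gamma> = n"
    by (auto simp: list_all2_conv_all_nth)
  then show ?thesis
    unfolding even_degs_def by (auto simp: product_lists_set)
qed

lemma length_Even_degs: "\<gamma> \<in> Even_degs n \<Longrightarrow> length \<gamma> = n"
  by (simp add: Even_degs_iff)

lemma deg_zero_even [simp]: "deg_zero n \<in> Even_degs n"
  by (simp add: Even_degs_iff sprod_zero_left) (simp add: deg_zero_def)

lemma deg_add_even [simp]: "\<gamma> \<in> Even_degs n \<Longrightarrow> \<delta> \<in> Even_degs n \<Longrightarrow> \<gamma> \<oplus>\<^sub>d \<delta> \<in> Even_degs n"
proof -
  assume "\<gamma> \<in> Even_degs n" "\<delta> \<in> Even_degs n"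
  then have [simp]: "length \<gamma> = n" "length \<delta> = n" "sprod \<gamma> \<gamma> = 0" "sprod \<delta> \<delta> = 0"
    by (simp_all add: Even_degs_iff)
  have "sprod (\<gamma> \<oplus>\<^sub>d \<delta>) (\<gamma> \<oplus>\<^sub>d \<delta>) = sprod \<gamma> (\<gamma> \<oplus>\<^sub>d \<delta>) + sprod \<delta> (\<gamma> \<oplus>\<^sub>d \<delta>)"
    by (simp add: sprod_add_left)
  also have "\<dots> = sprod \<gamma> \<delta> + sprod \<gamma> \<delta>"
    by (simp add: sprod_commute[of _ "\<gamma> \<oplus>\<^sub>d \<delta>"] sprod_add_left sprod_commute[of \<delta> \<gamma>])
  finally show ?thesis by (simp add: Even_degs_iff length_deg_add)
qed

lemma deg_add_zero [simp]:
  "\<gamma> \<in> Even_degs n \<Longrightarrow> deg_zero n \<oplus>\<^sub>d \<gamma> = \<gamma>" "\<gamma> \<in> Even_degs n \<Longrightarrow> \<gamma> \<oplus>\<^sub>d deg_zero n = \<gamma>"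
  by (metis deg_add_zero_left deg_add_commute length_Even_degs)+

lemma deg_add_cancel [simp]:
  "\<gamma> \<in> Even_degs n \<Longrightarrow> \<gamma> \<oplus>\<^sub>d \<gamma> = deg_zero n"
  "\<gamma> \<in> Even_degs n \<Longrightarrow> \<delta> \<in> Even_degs n \<Longrightarrow> \<gamma> \<oplus>\<^sub>d (\<gamma> \<oplus>\<^sub>d \<delta>) = \<delta>"
  by (simp_all add: length_Even_degs deg_add_self flip: deg_add_assoc)

lemma bij_betw_deg_add: "\<gamma> \<in> Even_degs n \<Longrightarrow> bij_betw ((\<oplus>\<^sub>d) \<gamma>) (Even_degs n) (Even_degs n)"
  by (rule bij_betw_byWitness[where f' = "(\<oplus>\<^sub>d) \<gamma>"]) auto

text \<open>Prefixing a bit \<open>1\<close> flips the parity, so exactly half of all vectors have either parity. The induction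
  has to count both parities at once.\<close>

lemma length_even_degs:
  assumes "1 \<le> n"
  shows "length (even_degs n) = 2 ^ (n - 1)"
proof -
  define parity where "parity b \<gamma> \<longleftrightarrow> sprod \<gamma> \<gamma> = b" for b :: bit and \<gamma> :: degree
  have "length (filter (parity b) (product_lists (replicate (Suc m) [0, 1]))) = 2 ^ m" for b m
  proof (induction m arbitrary: b)
    case 0
    show ?case by (cases b) (simp_all add: parity_def sprod_def)
  next
    case (Suc m)
    let ?P = "product_lists (replicate (Suc m) [0, 1 :: bit])"
    have "filter (parity b) (map ((#) 0) ?P) = map ((#) 0) (filter (parity b) ?P)"
      by (simp add: filter_map comp_def parity_def sprod_def)
    moreover have "filter (parity b) (map ((#) 1) ?P) = map ((#) 1) (filter (parity (b + 1)) ?P)"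
    proof -
      have "parity b (1 # \<gamma>) = parity (b + 1) \<gamma>" for \<gamma>
        by (cases b; cases "sprod \<gamma> \<gamma>") (simp_all add: parity_def sprod_def)
      then show ?thesis by (simp add: filter_map comp_def)
    qed
    moreover have "product_lists (replicate (Suc (Suc m)) [0, 1 :: bit]) = map ((#) 0) ?P @ map ((#) 1) ?P"
      by (subst replicate_Suc, subst product_lists.simps(2)) (simp only: list.map concat.simps append_Nil2)
    ultimately show ?case
      by (simp only: filter_append length_append length_map Suc.IH) simp
  qed
  from this[of 0 "n - 1"] assms show ?thesis
    by (simp add: even_degs_def parity_def[abs_def])
qed

lemma gsign_cases: "gsign \<gamma> \<delta> = (1 :: 'a::ring_1) \<or> gsign \<gamma> \<delta> = (- 1 :: 'a)"
  by (simp add: gsign_def)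

lemma gsign_add_left:
  assumes "length \<gamma> = length \<delta>"
  shows "(gsign (\<gamma> \<oplus>\<^sub>d \<delta>) \<epsilon> :: 'a::ring_1) = gsign \<gamma> \<epsilon> * gsign \<delta> \<epsilon>"
  unfolding gsign_def sprod_add_left[OF assms]
  by (cases "sprod \<gamma> \<epsilon>"; cases "sprod \<delta> \<epsilon>") simp_all

lemma gsign_commute: "gsign \<gamma> \<delta> = gsign \<delta> \<gamma>"
  by (simp add: gsign_def sprod_commute)

lemma gsign_zero_left [simp]: "gsign (deg_zero n) \<gamma> = 1"
  by (simp add: gsign_def sprod_zero_left)

lemma central_gsign [simp]: "central (gsign \<gamma> \<delta>)"
  by (simp add: gsign_def central_def)

lemma gsign_square [simp]: "gsign \<gamma> \<delta> * gsign \<gamma> \<delta> = (1 :: 'a::ring_1)"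
  by (simp add: gsign_def)

lemma gsign_square_left [simp]: "gsign \<gamma> \<delta> * (gsign \<gamma> \<delta> * x) = (x :: 'a::ring_1)"
  by (simp flip: mult.assoc)

section \<open>Homogeneous elements\<close>

context graded_comm_algebra
begin

lemma component_zero [simp]: "\<gamma> \<in> Even_degs n \<Longrightarrow> 0 \<in> A \<gamma>"
  using subspace_component subspace_0 by blast

lemma component_uminus: "\<gamma> \<in> Even_degs n \<Longrightarrow> x \<in> A \<gamma> \<Longrightarrow> - x \<in> A \<gamma>"
  using subspace_component subspace_neg by blast

lemma component_sum: "\<gamma> \<in> Even_degs n \<Longrightarrow> (\<And>i. i \<in> I \<Longrightarrow> f i \<in> A \<gamma>) \<Longrightarrow> sum f I \<in> A \<gamma>"
  using subspace_component subspace_sum by blast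

lemma component_gsign: "\<gamma> \<in> Even_degs n \<Longrightarrow> x \<in> A \<gamma> \<Longrightarrow> gsign \<delta> \<epsilon> * x \<in> A \<gamma>"
  by (simp add: gsign_def component_uminus)

lemma component_mult_left: "\<gamma> \<in> Even_degs n \<Longrightarrow> c \<in> A (deg_zero n) \<Longrightarrow> x \<in> A \<gamma> \<Longrightarrow> c * x \<in> A \<gamma>"
  using component_mult[of "deg_zero n" \<gamma> c x] by simp

lemma homogeneous_decomposition:
  obtains f where "\<And>\<gamma>. \<gamma> \<in> Even_degs n \<Longrightarrow> f \<gamma> \<in> A \<gamma>" "x = (\<Sum>\<gamma>\<in>Even_degs n. f \<gamma>)"
  using direct_sum[of x] by (metis PiE_mem)

lemma homogeneous_decomposition_unique:
  assumes f: "\<And>\<gamma>. \<gamma> \<in> Even_degs n \<Longrightarrow> f \<gamma> \<in> A \<gamma>" and g: "\<And>\<gamma>. \<gamma> \<in> Even_degs n \<Longrightarrow> g \<gamma> \<in> A \<gamma>"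
    and eq: "(\<Sum>\<gamma>\<in>Even_degs n. f \<gamma>) = (\<Sum>\<gamma>\<in>Even_degs n. g \<gamma>)" and \<gamma>: "\<gamma> \<in> Even_degs n"
  shows "f \<gamma> = g \<gamma>"
proof -
  have "restrict f (Even_degs n) = restrict g (Even_degs n)"
  proof (rule ex1E[OF direct_sum[of "\<Sum>\<gamma>\<in>Even_degs n. f \<gamma>"]])
    fix h
    assume "\<forall>h'. h' \<in> (\<Pi>\<^sub>E \<gamma>\<in>Even_degs n. A \<gamma>) \<and>
      (\<Sum>\<gamma>\<in>Even_degs n. f \<gamma>) = (\<Sum>\<gamma>\<in>Even_degs n. h' \<gamma>) \<longrightarrow> h' = h"
    moreover have "restrict f (Even_degs n) \<in> (\<Pi>\<^sub>E \<gamma>\<in>Even_degs n. A \<gamma>)"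
      "restrict g (Even_degs n) \<in> (\<Pi>\<^sub>E \<gamma>\<in>Even_degs n. A \<gamma>)"
      using f g by auto
    moreover have "sum (restrict f (Even_degs n)) (Even_degs n) = sum f (Even_degs n)"
      "sum (restrict g (Even_degs n)) (Even_degs n) = sum g (Even_degs n)"
      by (auto intro: sum.cong)
    ultimately show ?thesis using eq by metis
  qed
  then show ?thesis using \<gamma> by (metis restrict_apply')
qed

lemma homogeneous_component:
  assumes f: "\<And>\<delta>. \<delta> \<in> Even_degs n \<Longrightarrow> f \<delta> \<in> A \<delta>" and \<gamma>: "\<gamma> \<in> Even_degs n"
    and x: "(\<Sum>\<delta>\<in>Even_degs n. f \<delta>) \<in> A \<gamma>"
  shows "f \<gamma> = (\<Sum>\<delta>\<in>Even_degs n. f \<delta>)"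
proof -
  let ?g = "\<lambda>\<delta>. if \<delta> = \<gamma> then (\<Sum>\<delta>\<in>Even_degs n. f \<delta>) else 0"
  have "f \<gamma> = ?g \<gamma>"
    by (rule homogeneous_decomposition_unique) (use f x \<gamma> in auto)
  then show ?thesis by simp
qed

lemma homogeneous_zero:
  assumes "\<gamma> \<in> Even_degs n" "\<delta> \<in> Even_degs n" "\<gamma> \<noteq> \<delta>" "x \<in> A \<gamma>" "x \<in> A \<delta>"
  shows "x = 0"
proof -
  let ?f = "\<lambda>\<epsilon>. if \<epsilon> = \<delta> then x else 0"
  have "?f \<gamma> = (\<Sum>\<epsilon>\<in>Even_degs n. ?f \<epsilon>)"
    by (rule homogeneous_component) (use assms in auto)
  then show ?thesis using assms by simp
qed

text \<open>Multiplication by a homogeneous element permutes the components, so a homogeneous product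
  is already attained on a single component of the second factor.\<close>

lemma component_of_left_mult:
  assumes f: "\<And>\<delta>. \<delta> \<in> Even_degs n \<Longrightarrow> f \<delta> \<in> A \<delta>"
    and \<gamma>: "\<gamma> \<in> Even_degs n" and \<epsilon>: "\<epsilon> \<in> Even_degs n" and a: "a \<in> A \<gamma>"
    and mem: "a * (\<Sum>\<delta>\<in>Even_degs n. f \<delta>) \<in> A \<epsilon>"
  shows "a * f (\<gamma> \<oplus>\<^sub>d \<epsilon>) = a * (\<Sum>\<delta>\<in>Even_degs n. f \<delta>)"
proof -
  have "a * (\<Sum>\<delta>\<in>Even_degs n. f \<delta>) = (\<Sum>\<delta>\<in>Even_degs n. a * f (\<gamma> \<oplus>\<^sub>d \<delta>))"
    unfolding sum_distrib_left
    by (rule sum.reindex_bij_betw[OF bij_betw_deg_add[OF \<gamma>], symmetric])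
  moreover have "a * f (\<gamma> \<oplus>\<^sub>d \<delta>) \<in> A \<delta>" if "\<delta> \<in> Even_degs n" for \<delta>
    using component_mult[OF \<gamma> deg_add_even[OF \<gamma> that] a f[OF deg_add_even[OF \<gamma> that]]] \<gamma> that by simp
  ultimately show ?thesis
    using homogeneous_component[of "\<lambda>\<delta>. a * f (\<gamma> \<oplus>\<^sub>d \<delta>)" \<epsilon>] \<epsilon> mem by simp
qed

text \<open>The degree zero component \<open>e\<close> of the unit satisfies \<open>a * e = a\<close> for homogeneous \<open>a\<close>, hence for all
  \<open>a\<close>, hence it is the unit.\<close>

lemma one_in_component_zero: "1 \<in> A (deg_zero n)"
proof -
  obtain e where e: "\<And>\<gamma>. \<gamma> \<in> Even_degs n \<Longrightarrow> e \<gamma> \<in> A \<gamma>" and one: "1 = (\<Sum>\<gamma>\<in>Even_degs n. e \<gamma>)"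
    using homogeneous_decomposition[of 1] by auto
  have hom: "a * e (deg_zero n) = a" if "\<gamma> \<in> Even_degs n" "a \<in> A \<gamma>" for a \<gamma>
    using component_of_left_mult[OF e that(1) that(1) that(2)] that by (simp flip: one)
  have "1 * e (deg_zero n) = 1"
    unfolding one sum_distrib_right by (intro sum.cong refl) (use hom e in auto)
  then show ?thesis using e[of "deg_zero n"] by simp
qed

text \<open>The component of the inverse in the degree of \<open>q\<close> is itself a right inverse of \<open>q\<close>, so there are
  no further components.\<close>

lemma component_inverse:
  assumes "\<gamma> \<in> Even_degs n" "q \<in> A \<gamma>" "q * q' = 1" "q' * q = 1"
  shows "q' \<in> A \<gamma>"
proof -
  obtain f where f: "\<And>\<gamma>. \<gamma> \<in> Even_degs n \<Longrightarrow> f \<gamma> \<in> A \<gamma>" and q': "q' = (\<Sum>\<gamma>\<in>Even_degs n. f \<gamma>)"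
    using homogeneous_decomposition[of q'] by auto
  have "q * f \<gamma> = 1"
    using component_of_left_mult[OF f assms(1) deg_zero_even assms(2)] assms one_in_component_zero
    by (simp flip: q')
  then have "f \<gamma> = q'" by (metis assms(4) mult.assoc mult.left_neutral mult.right_neutral)
  with f assms(1) show ?thesis by metis
qed

lemma central_component_zero:
  assumes c: "c \<in> A (deg_zero n)"
  shows "central c"
  unfolding central_def
proof
  fix y
  obtain f where f: "\<And>\<gamma>. \<gamma> \<in> Even_degs n \<Longrightarrow> f \<gamma> \<in> A \<gamma>" and y: "y = (\<Sum>\<gamma>\<in>Even_degs n. f \<gamma>)"
    using homogeneous_decomposition[of y] by auto
  have "c * f \<gamma> = f \<gamma> * c" if "\<gamma> \<in> Even_degs n" for \<gamma>
    using graded_commute[OF deg_zero_even that c f[OF that]] by simp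
  then show "c * y = y * c"
    unfolding y sum_distrib_left sum_distrib_right by (intro sum.cong) auto
qed

lemma component_power:
  assumes "\<gamma> \<in> Even_degs n" "q \<in> A \<gamma>"
  shows "q ^ k \<in> A (((\<oplus>\<^sub>d) \<gamma> ^^ k) (deg_zero n)) \<and> ((\<oplus>\<^sub>d) \<gamma> ^^ k) (deg_zero n) \<in> Even_degs n"
  by (induction k) (use assms in \<open>auto simp: one_in_component_zero component_mult\<close>)

lemma prod_list_homogeneous:
  assumes "\<And>i. i \<in> set is \<Longrightarrow> deg i \<in> Even_degs n"
  shows "\<exists>\<gamma>\<in>Even_degs n. \<forall>x. (\<forall>i\<in>set is. x i \<in> A (deg i)) \<longrightarrow> prod_list (map x is) \<in> A \<gamma>"
  using assms
proof (induction "is")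
  case Nil
  then show ?case using one_in_component_zero by auto
next
  case (Cons i "is")
  then obtain \<gamma> where "\<gamma> \<in> Even_degs n"
    "\<forall>x. (\<forall>i\<in>set is. x i \<in> A (deg i)) \<longrightarrow> prod_list (map x is) \<in> A \<gamma>" by auto
  with Cons.prems show ?case
    by (intro bexI[of _ "deg i \<oplus>\<^sub>d \<gamma>"]) (auto intro: component_mult)
qed

text \<open>Reordering a product of homogeneous factors costs a sign that depends on the degrees alone. That
  the sign is uniform in the factors makes the determinant below a polynomial in the entries.\<close>

lemma reorder_homogeneous_prod:
  assumes "mset is = mset js" "\<And>i. i \<in> set is \<Longrightarrow> deg i \<in> Even_degs n"
  shows "\<exists>c\<in>{1, - 1}. \<forall>x. (\<forall>i\<in>set is. x i \<in> A (deg i)) \<longrightarrow>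
           prod_list (map x is) = c * prod_list (map x js)"
  using assms
proof (induction "is" arbitrary: js)
  case Nil
  then show ?case by simp
next
  case (Cons i "is")
  then have "i \<in> set js" by (metis list.set_intros(1) mset_eq_setD)
  then obtain as bs where js: "js = as @ i # bs" by (meson split_list)
  with Cons.prems have ms: "mset is = mset (as @ bs)" by simp
  then have set: "set is = set as \<union> set bs" by (metis mset_eq_setD set_append)
  have "\<exists>c\<in>{1, - 1}. \<forall>x. (\<forall>i\<in>set is. x i \<in> A (deg i)) \<longrightarrow>
      prod_list (map x is) = c * prod_list (map x (as @ bs))"
    using Cons.IH[OF ms] Cons.prems(2) by (meson list.set_intros(2))
  then obtain c where c: "c \<in> {1, - 1}"
    and IH: "\<And>x. (\<forall>i\<in>set is. x i \<in> A (deg i)) \<Longrightarrow> prod_list (map x is) = c * prod_list (map x (as @ bs))"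
    by blast
  obtain \<gamma> where \<gamma>: "\<gamma> \<in> Even_degs n"
    and as: "\<And>x. (\<forall>i\<in>set as. x i \<in> A (deg i)) \<Longrightarrow> prod_list (map x as) \<in> A \<gamma>"
    using prod_list_homogeneous[of as deg] Cons.prems set by auto
  define g :: 'a where "g = gsign \<gamma> (deg i)"
  have "prod_list (map x (i # is)) = g * c * prod_list (map x js)"
    if x: "\<forall>k\<in>set (i # is). x k \<in> A (deg k)" for x
  proof -
    have "x i * prod_list (map x as) = g * (prod_list (map x as) * x i)"
      unfolding g_def using graded_commute[OF \<gamma> _ as, of "deg i" x "x i"] Cons.prems x set by auto
    moreover have "prod_list (map x is) = c * (prod_list (map x as) * prod_list (map x bs))"
      using IH[of x] x by simp
    ultimately show ?thesis
      unfolding js using c by (elim insertE) (simp_all flip: mult.assoc)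
  qed
  moreover have "g * c \<in> {1, - 1}" using c gsign_cases[of \<gamma> "deg i", where 'a = 'a] by (auto simp: g_def)
  ultimately show ?case by blast
qed

end


section \<open>Existence of the graded determinant in degree zero\<close>

lemma mset_concat_triple:
  "mset (concat (map (\<lambda>i. [f i, g i, h i]) is)) =
     image_mset f (mset is) + image_mset g (mset is) + image_mset h (mset is)"
  by (induction "is") auto

lemma mset_concat_pair:
  "mset (concat (map (\<lambda>i. [f i, g i]) is)) = image_mset f (mset is) + image_mset g (mset is)"
  by (induction "is") auto

lemma window_map_mat:
  assumes "M \<in> carrier_mat m l" "i + h \<le> m" "j + w \<le> l"
  shows "window (map_mat f M) i h j w = map_mat f (window M i h j w)"
  by (rule eq_matI) (use assms in auto)

lemma central_mat_map_of_center: "central_mat (map_mat of_center M)"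
  by (simp add: central_mat_def)

text \<open>The determinant of a matrix that is the identity modulo \<open>2\<close> is odd, hence nonzero in
  characteristic zero. Such matrices form a grid: each entry varies independently in an infinite set.\<close>

lemma odd_mat_inverse:
  fixes T :: "int mat"
  assumes T: "T \<in> carrier_mat m m"
    and par: "\<And>i j. i < m \<Longrightarrow> j < m \<Longrightarrow> odd (T $$ (i, j)) \<longleftrightarrow> i = j"
  shows "\<exists>W. mat_inverse_of (map_mat of_int T :: 'k::field_char_0 mat) W"
proof -
  have "map_mat of_int T = (1\<^sub>m m :: bit mat)"
  proof (rule eq_matI)
    fix i j assume "i < dim_row (1\<^sub>m m :: bit mat)" "j < dim_col (1\<^sub>m m :: bit mat)"
    then show "map_mat of_int T $$ (i, j) = (1\<^sub>m m :: bit mat) $$ (i, j)"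
      using T par[of i j] by (cases "odd (T $$ (i, j))") (auto elim!: evenE oddE)
  qed (use T in auto)
  then have "(of_int (det T) :: bit) = 1"
    by (metis det_one of_int_hom.hom_det)
  then have "det T \<noteq> 0" by auto
  define M where "M = (map_mat of_int T :: 'k mat)"
  have M: "M \<in> carrier_mat m m" using T by (simp add: M_def)
  have d: "det M \<noteq> 0" using \<open>det T \<noteq> 0\<close> unfolding M_def of_int_hom.hom_det by simp
  have "inverse (det M) \<cdot>\<^sub>m (det M \<cdot>\<^sub>m 1\<^sub>m m) = 1\<^sub>m m"
    by (rule eq_matI) (use d in auto)
  then have "mat_inverse_of M (inverse (det M) \<cdot>\<^sub>m adj_mat M)"
    using adj_mat[OF M] M
    by (simp add: mat_inverse_of_def inverts_mat_def mult_smult_distrib[of _ m m _ m]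
        mult_smult_assoc_mat[of _ m m _ m] carrier_matD[OF M] carrier_matD[OF adj_mat(1)[OF M]])
  then show ?thesis unfolding M_def by blast
qed

text \<open>The invertible homogeneous elements play the role of the basis of a crossed product: they identify
  each component with the one of degree zero.\<close>

locale crossed_graded_algebra = graded_comm_algebra scale n A
  for scale :: "'k::field_char_0 \<Rightarrow> 'a::ring_1 \<Rightarrow> 'a" and n :: nat and A :: "degree \<Rightarrow> 'a set" +
  fixes r :: "nat list"
  assumes n_pos: "1 \<le> n"
    and units: "\<gamma> \<in> Even_degs n \<Longrightarrow> \<exists>q\<in>A \<gamma>. invertible_elem q"
    and length_r: "length r = 2 ^ (n - 1)"
begin

abbreviation "N \<equiv> sum_list r"
abbreviation "M0 \<equiv> graded_mats n A r (deg_zero n)"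
abbreviation "\<rho> \<equiv> row_deg n r"

lemmas deg_add_cancel_n [simp] = deg_add_cancel[where n = n]

lemma row_deg_even [simp]: "i < N \<Longrightarrow> \<rho> i \<in> Even_degs n"
  unfolding row_deg_def
  by (rule nth_mem) (use block_of_less_length[of i r] length_even_degs[OF n_pos] length_r in simp)

text \<open>An invertible homogeneous element is chosen per degree, not per row, so that it is constant on the
  rows of a block.\<close>

definition unit_pair :: "degree \<Rightarrow> 'a \<times> 'a" where
  "unit_pair \<gamma> = (SOME (q, q'). q \<in> A \<gamma> \<and> q' \<in> A \<gamma> \<and> q * q' = 1 \<and> q' * q = 1)"

definition t :: "nat \<Rightarrow> 'a" where "t i = fst (unit_pair (\<rho> i))"
definition s :: "nat \<Rightarrow> 'a" where "s i = snd (unit_pair (\<rho> i))"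

lemma
  assumes "i < N"
  shows t_mem: "t i \<in> A (\<rho> i)" and s_mem: "s i \<in> A (\<rho> i)" and ts [simp]: "t i * s i = 1"
    and st [simp]: "s i * t i = 1"
proof -
  obtain q q' where "q \<in> A (\<rho> i)" "q * q' = 1" "q' * q = 1"
    using units[OF row_deg_even[OF assms]] by (auto simp: invertible_elem_def)
  then have "case (q, q') of (q, q') \<Rightarrow> q \<in> A (\<rho> i) \<and> q' \<in> A (\<rho> i) \<and> q * q' = 1 \<and> q' * q = 1"
    using component_inverse[OF row_deg_even[OF assms]] by auto
  then have "case unit_pair (\<rho> i) of (q, q') \<Rightarrow>
      q \<in> A (\<rho> i) \<and> q' \<in> A (\<rho> i) \<and> q * q' = 1 \<and> q' * q = 1"
    unfolding unit_pair_def by (rule someI)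
  then show "t i \<in> A (\<rho> i)" "s i \<in> A (\<rho> i)" "t i * s i = 1" "s i * t i = 1"
    by (auto simp: t_def s_def split: prod.splits)
qed

lemma ts_block:
  assumes "block_of r i = block_of r j"
  shows "t i = t j" "s i = s j"
  using assms by (simp_all add: t_def s_def row_deg_def)

lemma graded_matsD:
  assumes "X \<in> graded_mats n A r \<gamma>"
  shows "X \<in> carrier_mat N N"
    and "i < N \<Longrightarrow> j < N \<Longrightarrow> X $$ (i, j) \<in> A (\<rho> i \<oplus>\<^sub>d \<rho> j \<oplus>\<^sub>d \<gamma>)"
  using assms by (auto simp: graded_mats_def)

lemma M0D: "X \<in> M0 \<Longrightarrow> i < N \<Longrightarrow> j < N \<Longrightarrow> X $$ (i, j) \<in> A (\<rho> i \<oplus>\<^sub>d \<rho> j)"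
  using graded_matsD(2)[of X "deg_zero n" i j] by simp

lemma M0I:
  "X \<in> carrier_mat N N \<Longrightarrow> (\<And>i j. i < N \<Longrightarrow> j < N \<Longrightarrow> X $$ (i, j) \<in> A (\<rho> i \<oplus>\<^sub>d \<rho> j)) \<Longrightarrow> X \<in> M0"
  by (auto simp: graded_mats_def)

lemma graded_mats_mult:
  assumes \<gamma>: "\<gamma> \<in> Even_degs n" "\<delta> \<in> Even_degs n"
    and X: "X \<in> graded_mats n A r \<gamma>" and Y: "Y \<in> graded_mats n A r \<delta>"
  shows "X * Y \<in> graded_mats n A r (\<gamma> \<oplus>\<^sub>d \<delta>)"
proof -
  note XD = graded_matsD[OF X] and YD = graded_matsD[OF Y]
  have "(X * Y) $$ (i, j) \<in> A (\<rho> i \<oplus>\<^sub>d \<rho> j \<oplus>\<^sub>d (\<gamma> \<oplus>\<^sub>d \<delta>))" if ij: "i < N" "j < N" for i j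
  proof -
    have "X $$ (i, k) * Y $$ (k, j) \<in> A (\<rho> i \<oplus>\<^sub>d \<rho> j \<oplus>\<^sub>d (\<gamma> \<oplus>\<^sub>d \<delta>))" if k: "k < N" for k
    proof -
      have "X $$ (i, k) * Y $$ (k, j) \<in> A ((\<rho> i \<oplus>\<^sub>d \<rho> k \<oplus>\<^sub>d \<gamma>) \<oplus>\<^sub>d (\<rho> k \<oplus>\<^sub>d \<rho> j \<oplus>\<^sub>d \<delta>))"
        using ij k \<gamma> by (intro component_mult XD(2) YD(2)) auto
      also have "(\<rho> i \<oplus>\<^sub>d \<rho> k \<oplus>\<^sub>d \<gamma>) \<oplus>\<^sub>d (\<rho> k \<oplus>\<^sub>d \<rho> j \<oplus>\<^sub>d \<delta>) =
          \<rho> k \<oplus>\<^sub>d (\<rho> k \<oplus>\<^sub>d (\<rho> i \<oplus>\<^sub>d \<rho> j \<oplus>\<^sub>d (\<gamma> \<oplus>\<^sub>d \<delta>)))"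
        by (simp only: deg_add_assoc deg_add_commute deg_add_left_commute)
      also have "\<dots> = \<rho> i \<oplus>\<^sub>d \<rho> j \<oplus>\<^sub>d (\<gamma> \<oplus>\<^sub>d \<delta>)"
        by (rule deg_add_cancel_n(2)) (use ij k \<gamma> in auto)
      finally show ?thesis .
    qed
    then have "(\<Sum>k\<in>{0..<N}. X $$ (i, k) * Y $$ (k, j)) \<in> A (\<rho> i \<oplus>\<^sub>d \<rho> j \<oplus>\<^sub>d (\<gamma> \<oplus>\<^sub>d \<delta>))"
      using ij \<gamma> by (intro component_sum) auto
    then show ?thesis using XD(1) YD(1) ij by (simp add: scalar_prod_def)
  qed
  then show ?thesis using XD(1) YD(1) by (auto simp: graded_mats_def)
qed

lemma M0_mult: "X \<in> M0 \<Longrightarrow> Y \<in> M0 \<Longrightarrow> X * Y \<in> M0"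
  using graded_mats_mult[of "deg_zero n" "deg_zero n" X Y] by simp

lemma untwisted_entry:
  assumes "X \<in> M0" "i < N" "j < N"
  shows "s i * X $$ (i, j) * t j \<in> A (deg_zero n)"
proof -
  have "s i * X $$ (i, j) * t j \<in> A (\<rho> i \<oplus>\<^sub>d (\<rho> i \<oplus>\<^sub>d \<rho> j) \<oplus>\<^sub>d \<rho> j)"
    using assms by (intro component_mult s_mem t_mem M0D) auto
  then show ?thesis using assms by simp
qed

text \<open>Conjugation by the diagonal matrix of the chosen units moves the entry \<open>(i, j)\<close>, of degree
  \<open>\<rho> i + \<rho> j\<close>, to degree zero. Outside \<open>M0\<close> the entries need not be central, and \<open>to_center\<close> is then
  unspecified.\<close>

definition untwist :: "'a mat \<Rightarrow> 'a center mat" where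
  "untwist X = map_mat to_center (twist s t X)"

lemma untwist_carrier [simp]: "X \<in> carrier_mat N N \<Longrightarrow> untwist X \<in> carrier_mat N N"
  by (simp add: untwist_def)

lemma M0_carrier: "X \<in> M0 \<Longrightarrow> X \<in> carrier_mat N N"
  by (rule graded_matsD(1))

lemma of_center_untwist:
  assumes X: "X \<in> M0"
  shows "map_mat of_center (untwist X) = twist s t X"
  unfolding untwist_def
  using M0_carrier[OF X] untwisted_entry[OF X]
  by (intro of_center_to_center_mat) (auto simp: central_mat_def intro: central_component_zero)

lemma untwist_mult:
  assumes X: "X \<in> M0" and Y: "Y \<in> M0"
  shows "untwist (X * Y) = untwist X * untwist Y"
proof (rule map_mat_of_center_inj)
  note c = M0_carrier[OF X] M0_carrier[OF Y]
  show "map_mat of_center (untwist (X * Y)) = map_mat of_center (untwist X * untwist Y)"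
    using c by (simp add: of_center_untwist M0_mult X Y of_center.mat_hom_mult[of _ N N _ N]
        twist_mult[of _ N N _ N])
qed

definition det0 :: "'a mat \<Rightarrow> 'a" where
  "det0 X = of_center (det (untwist X))"

lemma det0_mult: "X \<in> M0 \<Longrightarrow> Y \<in> M0 \<Longrightarrow> det0 (X * Y) = det0 X * det0 Y"
  by (simp add: det0_def untwist_mult det_mult[of _ N] M0_carrier times_center.rep_eq)

lemma det0_leibniz:
  assumes X: "X \<in> M0"
  shows "det0 X = (\<Sum>p | p permutes {0..<N}.
     of_int (sign p) * prod_list (map (\<lambda>i. s i * X $$ (i, p i) * t (p i)) [0..<N]))"
proof -
  have "det0 X = leibniz_det (twist s t X)"
    using leibniz_det_of_center[of "untwist X" N] M0_carrier[OF X]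
    by (simp add: det0_def of_center_untwist[OF X])
  also have "\<dots> = (\<Sum>p | p permutes {0..<N}.
     of_int (sign p) * prod_list (map (\<lambda>i. s i * X $$ (i, p i) * t (p i)) [0..<N]))"
    unfolding leibniz_det_def
  proof (rule sum.cong)
    fix p assume "p \<in> {p. p permutes {0..<N}}"
    then have "p permutes {0..<N}" by simp
    then show "of_int (sign p) * prod_list (map (\<lambda>i. twist s t X $$ (i, p i)) [0..<dim_row (twist s t X)])
      = of_int (sign p) * prod_list (map (\<lambda>i. s i * X $$ (i, p i) * t (p i)) [0..<N])"
      using M0_carrier[OF X] permutes_in_image[of p "{0..<N}"]
      by (intro arg_cong2[where f = "(*)"] refl arg_cong[where f = prod_list] map_cong) auto
  qed (use M0_carrier[OF X] in auto)
  finally show ?thesis .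
qed

lemma det0_mem: "X \<in> M0 \<Longrightarrow> det0 X \<in> A (deg_zero n)"
  unfolding det0_leibniz
proof (rule component_sum)
  fix p assume X: "X \<in> M0" and "p \<in> {p. p permutes {0..<N}}"
  then have p: "p i < N" if "i < N" for i
    using that permutes_in_image[of p "{0..<N}" i] by auto
  have "prod_list (map (\<lambda>i. s i * X $$ (i, p i) * t (p i)) [0..<k]) \<in> A (deg_zero n)" if "k \<le> N" for k
    using that
  proof (induction k)
    case (Suc k)
    then have "prod_list (map (\<lambda>i. s i * X $$ (i, p i) * t (p i)) [0..<k]) *
        (s k * X $$ (k, p k) * t (p k)) \<in> A (deg_zero n)"
      by (intro component_mult_left untwisted_entry X p) auto
    then show ?case by simp
  qed (simp add: one_in_component_zero)
  then show "of_int (sign p) * prod_list (map (\<lambda>i. s i * X $$ (i, p i) * t (p i)) [0..<N]) \<in> A (deg_zero n)"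
    by (auto simp: sign_def component_uminus)
qed simp

text \<open>In each Leibniz term every chosen unit occurs once inverted and once not, because \<open>p\<close> is a
  permutation. Moving the units together cancels them and leaves a sign independent of the matrix.\<close>

lemma untwisted_prod:
  assumes p: "p permutes {0..<N}"
  shows "\<exists>c\<in>{1, - 1}. \<forall>X\<in>M0. prod_list (map (\<lambda>i. s i * X $$ (i, p i) * t (p i)) [0..<N]) =
           c * prod_list (map (\<lambda>i. X $$ (i, p i)) [0..<N])"
proof -
  \<comment> \<open>Factors are labelled by pairs: tag 0 for the inverse units, 1 for the entries, 2 for the units.\<close>
  define deg where "deg = (\<lambda>(k :: nat, i). if k = 1 then \<rho> i \<oplus>\<^sub>d \<rho> (p i) else \<rho> i)"
  define x where "x X = (\<lambda>(k :: nat, i). if k = 0 then s i else if k = 1 then X $$ (i, p i) else t i)" for X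
  let ?is = "concat (map (\<lambda>i. [(0 :: nat, i), (1, i), (2, p i)]) [0..<N])"
  let ?js = "map (Pair (1 :: nat)) [0..<N] @ concat (map (\<lambda>i. [(0, i), (2, i)]) [0..<N])"
  have pN: "p i < N" if "i < N" for i
    using that permutes_in_image[OF p, of i] by auto
  have "image_mset (\<lambda>i. (2 :: nat, p i)) (mset [0..<N]) = image_mset (Pair 2) (image_mset p (mset_set {0..<N}))"
    by (simp add: multiset.map_comp comp_def)
  also have "\<dots> = image_mset (Pair 2) (mset [0..<N])"
    by (simp only: permutes_image_mset[OF p] mset_upt)
  finally have "mset ?is = mset ?js"
    by (simp only: mset_concat_triple mset_concat_pair mset_append mset_map ac_simps)
  then obtain c where unit: "c \<in> {1, - 1}" and
    c: "\<And>x. \<forall>i\<in>set ?is. x i \<in> A (deg i) \<Longrightarrow> prod_list (map x ?is) = c * prod_list (map x ?js)"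
    using reorder_homogeneous_prod[of ?is ?js deg] by (fastforce simp: deg_def pN)
  have left: "prod_list (map (x X) (concat (map (\<lambda>i. [(0, i), (1, i), (2, p i)]) is)))
      = prod_list (map (\<lambda>i. s i * X $$ (i, p i) * t (p i)) is)" for X "is"
    by (induction "is") (auto simp: x_def mult.assoc)
  have right: "prod_list (map (x X) ?js) = prod_list (map (\<lambda>i. X $$ (i, p i)) [0..<N])" for X
  proof -
    have "prod_list (map (x X) (concat (map (\<lambda>i. [(0, i), (2, i)]) is))) = 1"
      if "set is \<subseteq> {0..<N}" for "is"
      using that by (induction "is") (auto simp: x_def simp flip: mult.assoc)
    from this[of "[0..<N]"] show ?thesis by (simp add: x_def comp_def)
  qed
  have mem: "\<forall>i\<in>set ?is. x X i \<in> A (deg i)" if "X \<in> M0" for X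
    using that by (auto simp: x_def deg_def pN intro: s_mem t_mem M0D)
  show ?thesis
    using c[OF mem] unit unfolding left right by blast
qed

lemma entry_polynomial_unit:
  assumes "c \<in> {1, - 1}"
  shows "entry_polynomial scale N (\<lambda>X. c)"
  using assms entry_polynomial.const[of scale N 1] entry_polynomial.const[of scale N "- 1"] by auto

lemma entry_polynomial_sum:
  assumes "finite I" "\<And>i. i \<in> I \<Longrightarrow> entry_polynomial scale N (f i)"
  shows "entry_polynomial scale N (\<lambda>X. \<Sum>i\<in>I. f i X)"
  using assms
proof (induction I)
  case empty
  show ?case using entry_polynomial.const[of scale N 0] by simp
next
  case (insert i I)
  then show ?case by (simp add: entry_polynomial.add)
qed

lemma entry_polynomial_prod_list:
  assumes "\<And>i. i \<in> set is \<Longrightarrow> i < N \<and> p i < N"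
  shows "entry_polynomial scale N (\<lambda>X. prod_list (map (\<lambda>i. X $$ (i, p i)) is))"
  using assms
proof (induction "is")
  case Nil
  show ?case using entry_polynomial_unit[of 1] by simp
next
  case (Cons i "is")
  then show ?case by (simp add: entry_polynomial.mult entry_polynomial.entry)
qed

lemma det0_polynomial: "\<exists>P. entry_polynomial scale N P \<and> (\<forall>X\<in>M0. det0 X = P X)"
proof -
  obtain c where "\<forall>p\<in>{p. p permutes {0..<N}}. c p \<in> {1, - 1} \<and>
     (\<forall>X\<in>M0. prod_list (map (\<lambda>i. s i * X $$ (i, p i) * t (p i)) [0..<N]) =
           c p * prod_list (map (\<lambda>i. X $$ (i, p i)) [0..<N]))"
    using bchoice[of "{p. p permutes {0..<N}}" "\<lambda>p c. c \<in> {1, - 1} \<and>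
     (\<forall>X\<in>M0. prod_list (map (\<lambda>i. s i * X $$ (i, p i) * t (p i)) [0..<N]) =
           c * prod_list (map (\<lambda>i. X $$ (i, p i)) [0..<N]))"] untwisted_prod by blast
  then have c: "\<And>p. p permutes {0..<N} \<Longrightarrow> c p \<in> {1, - 1}"
    and prod: "\<And>p X. p permutes {0..<N} \<Longrightarrow> X \<in> M0 \<Longrightarrow>
      prod_list (map (\<lambda>i. s i * X $$ (i, p i) * t (p i)) [0..<N]) =
           c p * prod_list (map (\<lambda>i. X $$ (i, p i)) [0..<N])"
    by blast+
  define P where "P X = (\<Sum>p | p permutes {0..<N}.
    of_int (sign p) * c p * prod_list (map (\<lambda>i. X $$ (i, p i)) [0..<N]))" for X
  have "entry_polynomial scale N P"
    unfolding P_def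
  proof (rule entry_polynomial_sum)
    fix p assume "p \<in> {p. p permutes {0..<N}}"
    then have p: "p permutes {0..<N}" by simp
    have "of_int (sign p) * c p \<in> {1, - 1}" using c[OF p] by (auto simp: sign_def)
    moreover have "i < N \<and> p i < N" if "i \<in> set [0..<N]" for i
      using that permutes_in_image[OF p, of i] by auto
    ultimately show "entry_polynomial scale N
        (\<lambda>X. of_int (sign p) * c p * prod_list (map (\<lambda>i. X $$ (i, p i)) [0..<N]))"
      by (intro entry_polynomial.mult[OF entry_polynomial_unit entry_polynomial_prod_list])
  qed (simp add: finite_permutations)
  moreover have "det0 X = P X" if "X \<in> M0" for X
    unfolding det0_leibniz[OF that] P_def
  proof (rule sum.cong)
    fix p assume "p \<in> {p. p permutes {0..<N}}"
    then show "of_int (sign p) * prod_list (map (\<lambda>i. s i * X $$ (i, p i) * t (p i)) [0..<N]) =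
        of_int (sign p) * c p * prod_list (map (\<lambda>i. X $$ (i, p i)) [0..<N])"
      by (simp only: prod[OF _ that] mem_Collect_eq) (simp only: mult.assoc)
  qed simp
  ultimately show ?thesis by blast
qed

lemma block_index:
  assumes "k < length r" "a < r ! k"
  shows "offset r k + a < N" "block_of r (offset r k + a) = k"
proof -
  show "block_of r (offset r k + a) = k"
    using assms by (intro block_of_eqI) (auto simp: offset_Suc)
  show "offset r k + a < N"
    using assms offset_le[of r "Suc k"] by (simp add: offset_Suc)
qed

lemma block_ends:
  assumes "k < length r"
  shows "offset r k + r ! k \<le> N" "offset r k + r ! k = offset r (Suc k)"
  using assms offset_le[of r "Suc k"] by (simp_all add: offset_Suc)

text \<open>On a diagonal block the rescaling is conjugation by a single unit, which does nothing to
  central entries.\<close>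

lemma twist_block_central:
  assumes k: "k < length r" and M: "M \<in> carrier_mat (r ! k) (r ! k)"
    and cent: "central_mat (twist (\<lambda>a. s (offset r k + a)) (\<lambda>b. t (offset r k + b)) M)"
  shows "twist (\<lambda>a. s (offset r k + a)) (\<lambda>b. t (offset r k + b)) M = M"
proof (rule eq_matI)
  fix a b assume "a < dim_row M" "b < dim_col M"
  then have ab: "a < r ! k" "b < r ! k" using M by auto
  let ?i = "offset r k + a" and ?j = "offset r k + b"
  note i = block_index[OF k ab(1)] and j = block_index[OF k ab(2)]
  have same: "t ?j = t ?i" by (rule ts_block(1)) (simp add: i j)
  define y where "y = s ?i * M $$ (a, b) * t ?j"
  have "central y"
    using cent ab M by (auto simp: central_mat_def y_def)
  then have "t ?i * y * s ?i = y"
    using i(1) by (metis centralD mult.assoc mult.right_neutral ts)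
  moreover have "t ?i * y * s ?i = (t ?i * s ?i) * M $$ (a, b) * (t ?i * s ?i)"
    unfolding y_def same by (simp only: mult.assoc)
  ultimately have "y = M $$ (a, b)" using i(1) by simp
  then show "twist (\<lambda>a. s (offset r k + a)) (\<lambda>b. t (offset r k + b)) M $$ (a, b) = M $$ (a, b)"
    using ab M by (simp add: y_def)
qed (use M in auto)

lemma of_center_window_untwist:
  assumes X: "X \<in> M0" and "i + h \<le> N" "j + w \<le> N"
  shows "map_mat of_center (window (untwist X) i h j w) =
    twist (\<lambda>a. s (i + a)) (\<lambda>b. t (j + b)) (window X i h j w)"
  using assms M0_carrier[OF X]
  by (simp add: window_map_mat[of "untwist X" N N, symmetric] of_center_untwist twist_window)

lemma of_center_block_untwist:
  assumes X: "X \<in> M0" and k: "k < length r"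
  shows "map_mat of_center (block r (untwist X) k k) = block r X k k"
proof -
  note w = of_center_window_untwist[OF X block_ends(1)[OF k] block_ends(1)[OF k]]
  show ?thesis
    unfolding block_def w
    by (rule twist_block_central[OF k]) (use w in \<open>simp_all add: central_mat_map_of_center flip: w\<close>)
qed

lemma det0_block_triangular:
  assumes X: "X \<in> M0" and tri: "block_upper_triangular r X \<or> block_lower_triangular r X"
  shows "det0 X = prod_list (map (\<lambda>k. leibniz_det (block r X k k)) [0..<length r])"
proof -
  have zero: "untwist X $$ (i, j) = 0" if "X $$ (i, j) = 0" "i < N" "j < N" for i j
  proof -
    have "of_center (untwist X $$ (i, j)) = twist s t X $$ (i, j)"
      using of_center_untwist[OF X] that M0_carrier[OF X]
      by (metis index_map_mat(1) carrier_matD untwist_carrier)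
    then have "of_center (untwist X $$ (i, j)) = of_center 0"
      using that M0_carrier[OF X] by simp
    then show ?thesis by (simp only: of_center_inject)
  qed
  have "block_upper_triangular r (untwist X) \<or> block_lower_triangular r (untwist X)"
    using tri zero unfolding block_upper_triangular_def block_lower_triangular_def by blast
  then have "det0 X = of_center (prod_list (map (\<lambda>k. det (block r (untwist X) k k)) [0..<length r]))"
    unfolding det0_def using M0_carrier[OF X] by (subst det_block_triangular[of _ r]) auto
  also have "\<dots> = prod_list (map (\<lambda>k. leibniz_det (block r X k k)) [0..<length r])"
    unfolding of_center.hom_prod_list map_map
  proof (intro arg_cong[where f = prod_list] map_cong refl)
    fix k assume "k \<in> set [0..<length r]"
    then have k: "k < length r" by simp
    show "(of_center \<circ> (\<lambda>k. det (block r (untwist X) k k))) k = leibniz_det (block r X k k)"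
      using leibniz_det_of_center[OF block_carrier[of r "untwist X" k k]] of_center_block_untwist[OF X k]
      by simp
  qed
  finally show ?thesis .
qed

text \<open>Untwisting commutes with forming quasideterminants, since the scaling factors cancel in each
  product. The inverse \<open>Z k\<close> is arbitrary; its rescaling has central entries because it
  inverts a matrix with central entries.\<close>

lemma det0_quasidet:
  assumes X: "X \<in> M0" and Z: "\<And>k. k < length r \<Longrightarrow> mat_inverse_of (tail r X (Suc k)) (Z k)"
  shows "det0 X = prod_list (map (\<lambda>k. leibniz_det (quasidet r X k (Z k))) [0..<length r])"
proof -
  define o2 h where "o2 k = offset r (Suc k)" and "h k = N - o2 k" for k
  define Z' where "Z' k = map_mat to_center (twist (\<lambda>a. s (o2 k + a)) (\<lambda>b. t (o2 k + b)) (Z k))" for k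
  have key: "mat_inverse_of (tail r (untwist X) (Suc k)) (Z' k) \<and>
    map_mat of_center (quasidet r (untwist X) k (Z' k)) = quasidet r X k (Z k)"
    if k: "k < length r" for k
  proof -
    let ?o1 = "offset r k" and ?o2 = "o2 k" and ?h = "h k"
    let ?s = "\<lambda>a. s (?o2 + a)" and ?t = "\<lambda>a. t (?o2 + a)"
    let ?s1 = "\<lambda>a. s (?o1 + a)" and ?t1 = "\<lambda>a. t (?o1 + a)"
    have o2: "?o2 + ?h = N" using offset_le[of r "Suc k"] by (simp add: h_def o2_def)
    have o1: "?o1 + r ! k \<le> N" by (rule block_ends(1)[OF k])
    have T: "tail r X (Suc k) = window X ?o2 ?h ?o2 ?h"
      and T': "tail r (untwist X) (Suc k) = window (untwist X) ?o2 ?h ?o2 ?h"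
      by (simp_all add: tail_def Let_def o2_def h_def)
    have tail: "map_mat of_center (tail r (untwist X) (Suc k)) = twist ?s ?t (tail r X (Suc k))"
      unfolding T T' using o2 by (intro of_center_window_untwist[OF X]) auto
    have Tc: "tail r X (Suc k) \<in> carrier_mat ?h ?h" "tail r (untwist X) (Suc k) \<in> carrier_mat ?h ?h"
      by (simp_all add: T T')
    have Zc: "Z k \<in> carrier_mat ?h ?h"
      using Z[OF k] Tc by (auto simp: mat_inverse_of_def)
    have inv: "mat_inverse_of (twist ?s ?t (tail r X (Suc k))) (twist ?s ?t (Z k))"
      by (rule mat_inverse_of_twist[OF Tc(1) Z[OF k]]) (use o2 in auto)
    have "central_mat (twist ?s ?t (Z k))"
      by (rule central_mat_inverse[OF _ _ inv]) (use Tc in \<open>auto simp: central_mat_map_of_center simp flip: tail\<close>)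
    then have Z': "map_mat of_center (Z' k) = twist ?s ?t (Z k)"
      unfolding Z'_def by (rule of_center_to_center_mat)
    have Z'c: "Z' k \<in> carrier_mat ?h ?h" using Zc by (simp add: Z'_def)
    have "mat_inverse_of (tail r (untwist X) (Suc k)) (Z' k)"
      by (rule mat_inverse_of_map_of_center[OF Tc(2) Z'c]) (use inv in \<open>simp add: tail Z'\<close>)
    moreover have "map_mat of_center (quasidet r (untwist X) k (Z' k)) = quasidet r X k (Z k)"
    proof -
      let ?B = "\<lambda>X :: 'a mat. window X ?o1 (r ! k) ?o2 ?h" and ?C = "\<lambda>X :: 'a mat. window X ?o2 ?h ?o1 (r ! k)"
      let ?B' = "window (untwist X) ?o1 (r ! k) ?o2 ?h" and ?C' = "window (untwist X) ?o2 ?h ?o1 (r ! k)"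
      have B: "map_mat of_center ?B' = twist ?s1 ?t (?B X)"
        and C: "map_mat of_center ?C' = twist ?s ?t1 (?C X)"
        and D: "map_mat of_center (block r (untwist X) k k) = twist ?s1 ?t1 (block r X k k)"
        unfolding block_def using o1 o2 by (auto intro!: of_center_window_untwist[OF X])
      have "map_mat of_center (quasidet r (untwist X) k (Z' k)) =
          map_mat of_center (block r (untwist X) k k) -
          map_mat of_center ?B' * map_mat of_center (Z' k) * map_mat of_center ?C'"
      proof -
        have "map_mat of_center (?B' * Z' k * ?C') =
            map_mat of_center ?B' * map_mat of_center (Z' k) * map_mat of_center ?C'"
          using of_center.mat_hom_mult[OF mult_carrier_mat[OF window_carrier Z'c] window_carrier]
            of_center.mat_hom_mult[OF window_carrier Z'c] by metis
        moreover have "map_mat of_center (block r (untwist X) k k - ?B' * Z' k * ?C') =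
            map_mat of_center (block r (untwist X) k k) - map_mat of_center (?B' * Z' k * ?C')"
          by (rule eq_matI) (auto simp: minus_center.rep_eq carrier_matD[OF block_carrier])
        ultimately show ?thesis
          by (simp add: quasidet_def Let_def o2_def h_def)
      qed
      also have "\<dots> = twist ?s1 ?t1 (block r X k k) -
          twist ?s1 ?t (?B X) * twist ?s ?t (Z k) * twist ?s ?t1 (?C X)"
        by (simp only: B C D Z')
      also have "\<dots> = twist ?s1 ?t1 (block r X k k - ?B X * Z k * ?C X)"
      proof -
        have "twist ?s1 ?t (?B X) * twist ?s ?t (Z k) = twist ?s1 ?t (?B X * Z k)"
          by (rule twist_mult[of _ "r ! k" ?h _ ?h]) (use Zc o2 in auto)
        moreover have "twist ?s1 ?t (?B X * Z k) * twist ?s ?t1 (?C X) = twist ?s1 ?t1 (?B X * Z k * ?C X)"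
          by (rule twist_mult[of _ "r ! k" ?h _ "r ! k"]) (use Zc o2 in auto)
        moreover have "twist ?s1 ?t1 (block r X k k - ?B X * Z k * ?C X) =
            twist ?s1 ?t1 (block r X k k) - twist ?s1 ?t1 (?B X * Z k * ?C X)"
          by (rule twist_minus[of _ "r ! k" "r ! k"]) (use Zc in \<open>auto intro!: block_carrier mult_carrier_mat[of _ _ ?h]\<close>)
        ultimately show ?thesis by simp
      qed
      finally have eq: "map_mat of_center (quasidet r (untwist X) k (Z' k)) = twist ?s1 ?t1 (quasidet r X k (Z k))"
        by (simp add: quasidet_def Let_def o2_def h_def)
      have "quasidet r X k (Z k) \<in> carrier_mat (r ! k) (r ! k)"
        unfolding quasidet_def Let_def
        by (intro minus_carrier_mat mult_carrier_mat[of _ _ ?h])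
          (use Zc in \<open>auto simp: o2_def h_def\<close>)
      then show ?thesis
        unfolding eq by (rule twist_block_central[OF k]) (simp add: central_mat_map_of_center flip: eq)
    qed
    ultimately show ?thesis by blast
  qed
  have "det0 X = of_center (prod_list (map (\<lambda>k. det (quasidet r (untwist X) k (Z' k))) [0..<length r]))"
    unfolding det0_def using M0_carrier[OF X] key by (subst det_eq_prod_quasidet[of _ r Z']) auto
  also have "\<dots> = prod_list (map (\<lambda>k. leibniz_det (quasidet r X k (Z k))) [0..<length r])"
    unfolding of_center.hom_prod_list map_map
  proof (intro arg_cong[where f = prod_list] map_cong refl)
    fix k assume "k \<in> set [0..<length r]"
    then have k: "k < length r" by simp
    have "quasidet r (untwist X) k (Z' k) \<in> carrier_mat (r ! k) (r ! k)"
      unfolding quasidet_def Let_def by (intro minus_carrier_mat carrier_matI) auto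
    from leibniz_det_of_center[OF this]
    show "(of_center \<circ> (\<lambda>k. det (quasidet r (untwist X) k (Z' k)))) k = leibniz_det (quasidet r X k (Z k))"
      using key[OF k] by simp
  qed
  finally show ?thesis .
qed

lemma is_gdet0_det0: "is_gdet0 scale n A r (restrict det0 M0)"
proof -
  have diag: "det0 X = prod_list (map (\<lambda>k. leibniz_det (block r X k k)) [0..<length r])"
    if "X \<in> M0" "block_diagonal r X" for X
    using that by (intro det0_block_triangular)
      (auto simp: block_diagonal_def block_upper_triangular_def)
  have one: "leibniz_det (1\<^sub>m m) = (1 :: 'a)" for m
    using leibniz_det_of_center[of "1\<^sub>m m" m] by (simp add: of_center.mat_hom_one)
  have uni: "det0 X = 1" if "X \<in> M0" "block_unitriangular r X" for X
  proof -
    have "det0 X = prod_list (map (\<lambda>k. leibniz_det (block r X k k)) [0..<length r])"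
      using that by (intro det0_block_triangular) (auto simp: block_unitriangular_def)
    also have "\<dots> = prod_list (map (\<lambda>k. 1) [0..<length r])"
      using that by (intro arg_cong[where f = prod_list] map_cong) (auto simp: block_unitriangular_def one)
    finally show ?thesis by (simp add: map_replicate_const)
  qed
  obtain P where P: "entry_polynomial scale N P" "\<forall>X\<in>M0. det0 X = P X"
    using det0_polynomial by blast
  show ?thesis
    unfolding is_gdet0_def Let_def
  proof (intro conjI ballI allI impI)
    show "restrict det0 M0 \<in> M0 \<rightarrow>\<^sub>E A (deg_zero n)" by (auto intro: det0_mem)
    show "\<exists>p. entry_polynomial scale N p \<and> (\<forall>X\<in>M0. restrict det0 M0 X = p X)"
      using P by (intro exI[of _ P]) auto
  qed (simp_all add: M0_mult det0_mult diag uni det0_quasidet)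
qed

end


section \<open>Powers of a product of two elements commuting up to a sign\<close>

lemma even_sum_lessThan: "even (\<Sum>i<k. i) \<longleftrightarrow> k mod 4 \<in> {0, 1 :: nat}"
proof (induction k)
  case (Suc k)
  have "even k \<longleftrightarrow> even (k mod 4)" by (simp add: dvd_mod_iff)
  moreover have "k mod 4 \<in> {0, 1, 2, 3}" by auto
  ultimately show ?case using Suc.IH by (auto simp: mod_Suc)
qed simp

lemma minus_one_power_sum_lessThan:
  "(- 1 :: 'a::ring_1) ^ (\<Sum>i<k. i) = (if k mod 4 \<in> {0, 1} then 1 else - 1)"
  using even_sum_lessThan[of k] by (simp only: minus_one_power_iff)

text \<open>Sorting the word \<open>q p q p \<dots>\<close> moves the \<open>i\<close>-th \<open>q\<close>, counted from zero, past \<open>i\<close> letters \<open>p\<close>.\<close>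

lemma power_mult_anticommuting:
  fixes q p g :: "'a::ring_1"
  assumes pq: "p * q = g * (q * p)" and g: "central g"
  shows "(q * p) ^ k = g ^ (\<Sum>i<k. i) * (q ^ k * p ^ k)"
proof (induction k)
  case (Suc k)
  have gk: "g ^ m * x = x * g ^ m" for m x
    by (induction m) (simp_all, metis centralD[OF g] mult.assoc)
  have shift: "p ^ m * q = g ^ m * (q * p ^ m)" for m
  proof (induction m)
    case (Suc m)
    have "p ^ Suc m * q = p * (p ^ m * q)" by (simp add: mult.assoc)
    also have "\<dots> = p * g ^ m * q * p ^ m" by (simp only: Suc.IH mult.assoc)
    also have "\<dots> = g ^ m * (p * q) * p ^ m" by (simp only: gk[of m p, symmetric] mult.assoc)
    also have "\<dots> = g ^ Suc m * (q * p ^ Suc m)"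
      by (simp only: pq power_Suc2[of g] power_Suc[of p] mult.assoc)
    finally show ?case .
  qed simp
  have "(q * p) ^ Suc k = g ^ (\<Sum>i<k. i) * q ^ k * (p ^ k * q) * p"
    by (simp only: power_Suc2 Suc.IH mult.assoc)
  also have "\<dots> = g ^ (\<Sum>i<k. i) * (q ^ k * g ^ k) * q * p ^ k * p"
    by (simp only: shift mult.assoc)
  also have "\<dots> = g ^ (\<Sum>i<k. i) * g ^ k * (q ^ Suc k * p ^ Suc k)"
    by (simp only: gk[of k "q ^ k", symmetric] power_Suc2 mult.assoc)
  finally show ?case by (simp add: power_add)
qed simp

section \<open>Uniqueness of the graded determinant in degree zero\<close>

context crossed_graded_algebra
begin

lemma of_int_component_zero: "of_int m \<in> A (deg_zero n)"
  unfolding of_int_eq_scale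
  by (rule subspace_scale[OF subspace_component]) (simp_all add: one_in_component_zero)

lemma twisted_entry:
  assumes "x \<in> A (deg_zero n)" "i < N" "j < N"
  shows "t i * x * s j \<in> A (\<rho> i \<oplus>\<^sub>d \<rho> j)"
proof -
  have "t i * x * s j \<in> A (\<rho> i \<oplus>\<^sub>d deg_zero n \<oplus>\<^sub>d \<rho> j)"
    using assms by (intro component_mult t_mem s_mem) auto
  then show ?thesis using assms by simp
qed

lemma put_entry_M0:
  assumes "X \<in> M0" "i < N" "j < N" "e \<in> A (\<rho> i \<oplus>\<^sub>d \<rho> j)"
  shows "put_entry X i j e \<in> M0"
  using assms M0_carrier[OF assms(1)] by (intro M0I) (auto simp: put_entry_def M0D)

text \<open>Matrices all of whose entries are of this form have invertible tails, and they form a product of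
  infinite sets, one for each entry. This makes them dense enough to detect polynomials.\<close>

definition on_grid :: "'a mat \<Rightarrow> nat \<Rightarrow> nat \<Rightarrow> bool" where
  "on_grid X i j \<longleftrightarrow> (\<exists>c :: int. X $$ (i, j) = t i * of_int c * s j \<and> (odd c \<longleftrightarrow> i = j))"

lemma grid_tail_inverse:
  assumes X: "X \<in> M0" and grid: "\<And>i j. i < N \<Longrightarrow> j < N \<Longrightarrow> on_grid X i j"
  shows "\<exists>W. mat_inverse_of (tail r X k) W"
proof -
  interpret scalar: ring_hom "\<lambda>c. scale c (1 :: 'a)"
    by unfold_locales (simp_all add: scale_left_distrib flip: scale_mult_left)
  from grid have "\<exists>c :: int. X $$ (i, j) = t i * of_int c * s j \<and> (odd c \<longleftrightarrow> i = j)"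
    if "i < N" "j < N" for i j
    using that unfolding on_grid_def by blast
  then obtain c :: "nat \<Rightarrow> nat \<Rightarrow> int" where c: "\<And>i j. i < N \<Longrightarrow> j < N \<Longrightarrow>
      X $$ (i, j) = t i * of_int (c i j) * s j \<and> (odd (c i j) \<longleftrightarrow> i = j)"
    by metis
  define o' h where "o' = offset r k" and "h = N - o'"
  have h: "o' + h = N" using offset_le[of r k] by (simp add: h_def o'_def)
  define T where "T = mat h h (\<lambda>(a, b). c (o' + a) (o' + b))"
  have "\<exists>W. mat_inverse_of (map_mat of_int T :: 'k mat) W"
  proof (rule odd_mat_inverse)
    fix i j assume "i < h" "j < h"
    then show "odd (T $$ (i, j)) \<longleftrightarrow> i = j"
      using c[of "o' + i" "o' + j"] h by (simp add: T_def)
  qed (simp add: T_def)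
  then obtain W :: "'k mat" where W: "mat_inverse_of (map_mat of_int T) W" by blast
  have "map_mat (\<lambda>c. scale c (1 :: 'a)) (map_mat of_int T) = map_mat of_int T"
    by (rule eq_matI) (simp_all flip: of_int_eq_scale)
  moreover have Tc: "map_mat of_int T \<in> carrier_mat h h" by (simp add: T_def)
  moreover have Wc: "W \<in> carrier_mat h h" using W by (auto simp: mat_inverse_of_def T_def)
  ultimately have "mat_inverse_of (map_mat of_int T :: 'a mat) (map_mat (\<lambda>c. scale c 1) W)"
    using W scalar.mat_hom_mult[of "map_mat of_int T" h h W h] scalar.mat_hom_mult[of W h h "map_mat of_int T" h]
    by (auto simp: mat_inverse_of_def inverts_mat_def scalar.mat_hom_one T_def)
  then have "mat_inverse_of (twist (\<lambda>a. t (o' + a)) (\<lambda>b. s (o' + b)) (map_mat of_int T))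
      (twist (\<lambda>a. t (o' + a)) (\<lambda>b. s (o' + b)) (map_mat (\<lambda>c. scale c 1) W))"
    using Tc h by (intro mat_inverse_of_twist[of _ h]) (auto simp: T_def)
  moreover have "tail r X k = twist (\<lambda>a. t (o' + a)) (\<lambda>b. s (o' + b)) (map_mat of_int T)"
    by (rule eq_matI) (use c h in \<open>auto simp: tail_def Let_def T_def simp flip: o'_def h_def\<close>)
  ultimately show ?thesis by auto
qed

text \<open>Entries are released from the grid one at a time. Along a single entry the polynomial is a polynomial
  function of a central variable with infinitely many integral zeros, so it vanishes for every value
  of that entry.\<close>

lemma entry_polynomial_zero:
  assumes P: "entry_polynomial scale N P"
    and zero: "\<And>X. X \<in> M0 \<Longrightarrow> (\<And>i j. i < N \<Longrightarrow> j < N \<Longrightarrow> on_grid X i j) \<Longrightarrow> P X = 0"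
    and X: "X \<in> M0"
  shows "P X = 0"
proof -
  have "\<forall>X\<in>M0. (\<forall>i<N. \<forall>j<N. (i, j) \<notin> V \<longrightarrow> on_grid X i j) \<longrightarrow> P X = 0"
    if "finite V" "V \<subseteq> {..<N} \<times> {..<N}" for V
    using that
  proof (induction V)
    case empty
    then show ?case using zero by simp
  next
    case (insert v V)
    obtain i j where v: "v = (i, j)" by (cases v)
    have ij: "i < N" "j < N" using insert.prems v by auto
    show ?case
    proof (intro ballI impI)
      fix X assume X: "X \<in> M0"
        and grid: "\<forall>k<N. \<forall>l<N. (k, l) \<notin> insert v V \<longrightarrow> on_grid X k l"
      let ?f = "\<lambda>x. P (put_entry X i j (t i * x * s j))"
      let ?S = "{c :: int. odd c \<longleftrightarrow> i = j}"
      have zeros: "?f (of_int c) = 0" if "c \<in> ?S" for c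
      proof -
        let ?Y = "put_entry X i j (t i * of_int c * s j)"
        have "?Y \<in> M0" by (intro put_entry_M0 X ij twisted_entry of_int_component_zero)
        moreover have "on_grid ?Y k l" if "k < N" "l < N" "(k, l) \<notin> V" for k l
        proof (cases "(k, l) = (i, j)")
          case True
          then show ?thesis
            using ij M0_carrier[OF X] \<open>c \<in> _\<close> by (auto simp: on_grid_def put_entry_def)
        next
          case False
          then have "on_grid X k l" using grid that v by simp
          moreover have "?Y $$ (k, l) = X $$ (k, l)"
            using False that M0_carrier[OF X] by (auto simp: put_entry_def)
          ultimately show ?thesis by (simp add: on_grid_def)
        qed
        ultimately show ?thesis using insert.IH insert.prems by blast
      qed
      have inf: "infinite ?S"
      proof -
        have "inj (\<lambda>m :: int. 2 * m + (if i = j then 1 else 0))" by (auto intro: injI)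
        then have "infinite (range (\<lambda>m :: int. 2 * m + (if i = j then 1 else 0)))"
          using infinite_UNIV_int by (simp add: finite_image_iff)
        moreover have "range (\<lambda>m :: int. 2 * m + (if i = j then 1 else 0)) \<subseteq> ?S"
          by auto
        ultimately show ?thesis using finite_subset by blast
      qed
      have cent: "central (s i * X $$ (i, j) * t j)"
        by (intro central_component_zero untwisted_entry X ij)
      \<comment> \<open>This value of the variable gives back the original matrix.\<close>
      have "?f (s i * X $$ (i, j) * t j) = 0"
        by (rule center_polynomial_zero[where f = ?f and S = ?S,
              OF entry_polynomial_along_entry[OF P M0_carrier[OF X]] inf zeros cent])
      moreover have "t i * (s i * X $$ (i, j) * t j) * s j = (t i * s i) * X $$ (i, j) * (t j * s j)"
        by (simp only: mult.assoc)
      ultimately show "P X = 0" using ij by (simp add: put_entry_same)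
    qed
  qed
  from this[of "{..<N} \<times> {..<N}"] X show ?thesis by auto
qed

text \<open>The difference of two candidates is an entry polynomial, and it vanishes on the grid: there all
  the inverses in the quasideterminant formula exist, so that the formula determines the value.\<close>

lemma is_gdet0_unique:
  assumes d: "is_gdet0 scale n A r d" and d': "is_gdet0 scale n A r d'"
  shows "d = d'"
proof -
  obtain p where p: "entry_polynomial scale N p" "\<And>X. X \<in> M0 \<Longrightarrow> d X = p X"
    using d by (auto simp: is_gdet0_def Let_def)
  obtain p' where p': "entry_polynomial scale N p'" "\<And>X. X \<in> M0 \<Longrightarrow> d' X = p' X"
    using d' by (auto simp: is_gdet0_def Let_def)
  have "d X = d' X" if X: "X \<in> M0" for X
  proof -
    have "p X + (- 1) * p' X = 0"
    proof (rule entry_polynomial_zero[OF _ _ X])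
      show "entry_polynomial scale N (\<lambda>X. p X + (- 1) * p' X)"
        by (intro entry_polynomial.add[OF p(1)] entry_polynomial.mult[OF _ p'(1)] entry_polynomial_unit) simp
      fix Y assume Y: "Y \<in> M0" and "\<And>i j. i < N \<Longrightarrow> j < N \<Longrightarrow> on_grid Y i j"
      then have "\<forall>k. \<exists>W. mat_inverse_of (tail r Y (Suc k)) W"
        using grid_tail_inverse by blast
      then obtain Z where "\<And>k. mat_inverse_of (tail r Y (Suc k)) (Z k)" by metis
      then have "d Y = prod_list (map (\<lambda>k. leibniz_det (quasidet r Y k (Z k))) [0..<length r])"
        "d' Y = prod_list (map (\<lambda>k. leibniz_det (quasidet r Y k (Z k))) [0..<length r])"
        using d d' Y by (auto simp: is_gdet0_def Let_def)
      then show "p Y + (- 1) * p' Y = 0" using p(2)[OF Y] p'(2)[OF Y] by simp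
    qed
    then show ?thesis using p(2)[OF X] p'(2)[OF X] by simp
  qed
  moreover have "d \<in> extensional M0" "d' \<in> extensional M0"
    using d d' by (auto simp: is_gdet0_def Let_def PiE_def)
  ultimately show ?thesis by (intro extensionalityI)
qed

lemma gdet0_eq_det0:
  assumes "X \<in> M0"
  shows "gdet0 scale n A r X = det0 X"
proof -
  have "gdet0 scale n A r = restrict det0 M0"
    unfolding gdet0_def using is_gdet0_det0 is_gdet0_unique by blast
  with assms show ?thesis by simp
qed

section \<open>Homogeneous matrices of arbitrary degree\<close>

lemma smult_M0:
  assumes c: "c \<in> A (deg_zero n)" and X: "X \<in> M0"
  shows "c \<cdot>\<^sub>m X \<in> M0"
  using M0_carrier[OF X] by (intro M0I) (auto intro: component_mult_left c M0D[OF X])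

lemma det0_smult:
  assumes c: "c \<in> A (deg_zero n)" and X: "X \<in> M0"
  shows "det0 (c \<cdot>\<^sub>m X) = c ^ N * det0 X"
proof -
  note cent = central_component_zero[OF c]
  have "untwist (c \<cdot>\<^sub>m X) = to_center c \<cdot>\<^sub>m untwist X"
  proof (rule map_mat_of_center_inj)
    have "s i * (c * X $$ (i, j)) * t j = c * (s i * X $$ (i, j) * t j)" for i j
      using centralD[OF cent, of "s i"] by (metis mult.assoc)
    moreover have "map_mat of_center (to_center c \<cdot>\<^sub>m untwist X) = c \<cdot>\<^sub>m map_mat of_center (untwist X)"
      by (rule eq_matI) (auto simp: times_center.rep_eq of_center_to_center[OF cent])
    ultimately show "map_mat of_center (untwist (c \<cdot>\<^sub>m X)) = map_mat of_center (to_center c \<cdot>\<^sub>m untwist X)"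
      using M0_carrier[OF X]
      by (intro eq_matI) (auto simp: of_center_untwist[OF X] of_center_untwist[OF smult_M0[OF c X]])
  qed
  then show ?thesis
    using untwist_carrier[OF M0_carrier[OF X]]
    by (simp add: det0_def times_center.rep_eq of_center.hom_power of_center_to_center[OF cent])
qed

lemma det0_one: "1\<^sub>m N \<in> M0" "det0 (1\<^sub>m N) = 1"
proof -
  show one: "1\<^sub>m N \<in> M0"
    by (rule M0I) (auto simp: one_in_component_zero)
  have "untwist (1\<^sub>m N) = 1\<^sub>m N"
    by (rule map_mat_of_center_inj)
      (simp add: of_center_untwist[OF one] of_center.mat_hom_one twist_one)
  then show "det0 (1\<^sub>m N) = 1" by (simp add: det0_def one_center.rep_eq)
qed

lemma graded_smult_index:
  "i < N \<Longrightarrow> j < N \<Longrightarrow> graded_smult n r \<gamma> q X $$ (i, j) = gsign \<gamma> (\<rho> i) * q * X $$ (i, j)"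
  by (simp add: graded_smult_def)

lemma graded_smult_mem:
  assumes \<gamma>: "\<gamma> \<in> Even_degs n" and \<delta>: "\<delta> \<in> Even_degs n" and q: "q \<in> A \<gamma>"
    and X: "X \<in> graded_mats n A r \<delta>"
  shows "graded_smult n r \<gamma> q X \<in> graded_mats n A r (\<gamma> \<oplus>\<^sub>d \<delta>)"
proof -
  have "gsign \<gamma> (\<rho> i) * q * X $$ (i, j) \<in> A (\<rho> i \<oplus>\<^sub>d \<rho> j \<oplus>\<^sub>d (\<gamma> \<oplus>\<^sub>d \<delta>))" if ij: "i < N" "j < N" for i j
  proof -
    have "gsign \<gamma> (\<rho> i) * q * X $$ (i, j) \<in> A (\<gamma> \<oplus>\<^sub>d (\<rho> i \<oplus>\<^sub>d \<rho> j \<oplus>\<^sub>d \<delta>))"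
      using ij \<gamma> \<delta> q X by (intro component_mult component_gsign graded_matsD(2)) auto
    also have "\<gamma> \<oplus>\<^sub>d (\<rho> i \<oplus>\<^sub>d \<rho> j \<oplus>\<^sub>d \<delta>) = \<rho> i \<oplus>\<^sub>d \<rho> j \<oplus>\<^sub>d (\<gamma> \<oplus>\<^sub>d \<delta>)"
      by (simp only: deg_add_assoc deg_add_commute deg_add_left_commute)
    finally show ?thesis .
  qed
  then show ?thesis by (auto simp: graded_mats_def graded_smult_def)
qed

lemma factorization_exists:
  assumes \<gamma>: "\<gamma> \<in> Even_degs n" and X: "X \<in> graded_mats n A r \<gamma>"
  shows "\<exists>q X0. factorization n A r \<gamma> X q X0"
proof -
  obtain q q' where q: "q \<in> A \<gamma>" "q * q' = 1" "q' * q = 1"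
    using units[OF \<gamma>] by (auto simp: invertible_elem_def)
  have q': "q' \<in> A \<gamma>" by (rule component_inverse[OF \<gamma> q])
  let ?X0 = "graded_smult n r \<gamma> q' X"
  have "?X0 \<in> M0" using graded_smult_mem[OF \<gamma> \<gamma> q' X] \<gamma> by simp
  moreover have "X = graded_smult n r \<gamma> q ?X0"
  proof (rule eq_matI)
    fix i j assume "i < dim_row (graded_smult n r \<gamma> q ?X0)" "j < dim_col (graded_smult n r \<gamma> q ?X0)"
    then have ij: "i < N" "j < N" by (simp_all add: graded_smult_def)
    define g :: 'a where "g = gsign \<gamma> (\<rho> i)"
    have com: "q * g = g * q" unfolding g_def by (rule centralD[symmetric]) simp
    have "g * q * (g * q' * X $$ (i, j)) = g * (q * g) * q' * X $$ (i, j)"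
      by (simp only: mult.assoc)
    also have "\<dots> = (g * g) * (q * q') * X $$ (i, j)"
      unfolding com by (simp only: mult.assoc)
    finally show "X $$ (i, j) = graded_smult n r \<gamma> q ?X0 $$ (i, j)"
      using ij q by (simp add: graded_smult_index g_def)
  qed (use graded_matsD(1)[OF X] in \<open>auto simp: graded_smult_def\<close>)
  ultimately show ?thesis
    using q by (auto simp: factorization_def invertible_elem_def)
qed

lemma power_mult_central: "central c \<Longrightarrow> (q * c) ^ k = q ^ k * (c :: 'a) ^ k"
  using power_mult_anticommuting[of c q 1 k] by (simp add: centralD central_def)

text \<open>In the same degree two factorizations differ by an invertible scalar \<open>c\<close> of degree zero, and \<open>c ^ N\<close> is
  absorbed by the power of the unit. Only the zero matrix is homogeneous of two different degrees;
  its value is \<open>0\<close>, unless it is the empty matrix, whose value is \<open>1\<close>.\<close>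

lemma factorization_value_unique:
  assumes \<gamma>: "\<gamma> \<in> Even_degs n" and \<delta>: "\<delta> \<in> Even_degs n"
    and X0: "factorization n A r \<gamma> X q X0" and Y0: "factorization n A r \<delta> X p Y0"
  shows "q ^ N * det0 X0 = p ^ N * det0 Y0"
proof -
  from X0 obtain q' where q: "q \<in> A \<gamma>" "q * q' = 1" "q' * q = 1" and X0': "X0 \<in> M0"
    and X: "X = graded_smult n r \<gamma> q X0"
    by (auto simp: factorization_def invertible_elem_def)
  from Y0 obtain p' where p: "p \<in> A \<delta>" "p * p' = 1" "p' * p = 1" and Y0': "Y0 \<in> M0"
    and X': "X = graded_smult n r \<delta> p Y0"
    by (auto simp: factorization_def invertible_elem_def)
  note c = M0_carrier[OF X0'] M0_carrier[OF Y0']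
  have cancel: "x = b' * (gsign \<epsilon> (\<rho> i) * (gsign \<epsilon> (\<rho> i) * b * x))" if "b' * b = 1" for b b' x :: 'a and \<epsilon> i
  proof -
    have "b' * (gsign \<epsilon> (\<rho> i) * (gsign \<epsilon> (\<rho> i) * b * x)) = (b' * b) * x" by (simp add: mult.assoc)
    then show ?thesis using that by simp
  qed
  show ?thesis
  proof (cases "\<gamma> = \<delta>")
    case True
    have q': "q' \<in> A \<gamma>" by (rule component_inverse[OF \<gamma> q])
    have c0: "q' * p \<in> A (deg_zero n)" using component_mult[OF \<gamma> \<gamma> q'] p(1) True \<gamma> by simp
    have "X0 = (q' * p) \<cdot>\<^sub>m Y0"
    proof (rule eq_matI)
      fix i j assume "i < dim_row ((q' * p) \<cdot>\<^sub>m Y0)" "j < dim_col ((q' * p) \<cdot>\<^sub>m Y0)"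
      then have ij: "i < N" "j < N" using c by auto
      have "gsign \<gamma> (\<rho> i) * q * X0 $$ (i, j) = gsign \<gamma> (\<rho> i) * p * Y0 $$ (i, j)"
        using arg_cong[OF X[unfolded X'], of "\<lambda>M. M $$ (i, j)"] ij True by (simp add: graded_smult_index)
      then have "X0 $$ (i, j) = q' * (gsign \<gamma> (\<rho> i) * (gsign \<gamma> (\<rho> i) * p * Y0 $$ (i, j)))"
        using cancel[OF q(3), of "X0 $$ (i, j)" \<gamma> i] by simp
      then show "X0 $$ (i, j) = ((q' * p) \<cdot>\<^sub>m Y0) $$ (i, j)"
        using ij c by (simp add: mult.assoc)
    qed (use c in auto)
    then have "q ^ N * det0 X0 = q ^ N * (q' * p) ^ N * det0 Y0"
      by (simp add: det0_smult[OF c0 Y0'] mult.assoc)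
    also have "q ^ N * (q' * p) ^ N = (q * (q' * p)) ^ N"
      by (rule power_mult_central[symmetric]) (rule central_component_zero[OF c0])
    also have "q * (q' * p) = p" using q(2) by (simp flip: mult.assoc)
    finally show ?thesis .
  next
    case False
    show ?thesis
    proof (cases "N = 0")
      case True
      then have "X0 \<in> carrier_mat 0 0" "Y0 \<in> carrier_mat 0 0" using c by (simp_all only:)
      then have "X0 = Y0" by (intro eq_matI) auto
      then show ?thesis using True by (simp only: power_0)
    next
      case N: False
      have "X $$ (i, j) = 0" if ij: "i < N" "j < N" for i j
      proof (rule homogeneous_zero)
        show "X $$ (i, j) \<in> A (\<rho> i \<oplus>\<^sub>d \<rho> j \<oplus>\<^sub>d \<gamma>)"
          using graded_smult_mem[OF \<gamma> deg_zero_even q(1) X0'] \<gamma> ij unfolding X by (auto dest: graded_matsD(2))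
        show "X $$ (i, j) \<in> A (\<rho> i \<oplus>\<^sub>d \<rho> j \<oplus>\<^sub>d \<delta>)"
          using graded_smult_mem[OF \<delta> deg_zero_even p(1) Y0'] \<delta> ij unfolding X' by (auto dest: graded_matsD(2))
        show "\<rho> i \<oplus>\<^sub>d \<rho> j \<oplus>\<^sub>d \<gamma> \<noteq> \<rho> i \<oplus>\<^sub>d \<rho> j \<oplus>\<^sub>d \<delta>"
          using False deg_add_cancel_n(2)[of "\<rho> i \<oplus>\<^sub>d \<rho> j"] ij \<gamma> \<delta> by (metis deg_add_even row_deg_even)
      qed (use ij \<gamma> \<delta> in auto)
      then have zero: "X0 $$ (i, j) = 0" "Y0 $$ (i, j) = 0" if "i < N" "j < N" for i j
        using that cancel[OF q(3), of "X0 $$ (i, j)" \<gamma> i] cancel[OF p(3), of "Y0 $$ (i, j)" \<delta> i]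
          graded_smult_index[OF that, of \<gamma> q X0] graded_smult_index[OF that, of \<delta> p Y0]
        by (simp_all flip: X X')
      have "det0 M = 0" if "M \<in> M0" "\<And>i j. i < N \<Longrightarrow> j < N \<Longrightarrow> M $$ (i, j) = 0" for M
      proof -
        have "M = 0 \<cdot>\<^sub>m M" using that M0_carrier[of M] by (intro eq_matI) auto
        then have "det0 M = 0 ^ N * det0 M" using det0_smult[of 0 M] that by simp
        moreover have "(0 :: 'a) ^ N = 0" by (metis N power_0_left)
        ultimately show ?thesis by simp
      qed
      then show ?thesis using zero X0' Y0' by simp
    qed
  qed
qed

lemma gdet_factorization:
  assumes \<gamma>: "\<gamma> \<in> Even_degs n" and f: "factorization n A r \<gamma> X q X0"
  shows "gdet scale n A r X = q ^ N * det0 X0"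
  unfolding gdet_def
proof (rule the_equality)
  have "X0 \<in> M0" using f by (simp add: factorization_def)
  then show "\<exists>\<gamma>\<in>Even_degs n. \<exists>q' X0'. factorization n A r \<gamma> X q' X0' \<and>
      q ^ N * det0 X0 = q' ^ N * gdet0 scale n A r X0'"
    using \<gamma> f by (intro bexI[of _ \<gamma>] exI[of _ q] exI[of _ X0]) (auto simp: gdet0_eq_det0)
next
  fix d assume "\<exists>\<gamma>\<in>Even_degs n. \<exists>q' X0'. factorization n A r \<gamma> X q' X0' \<and>
      d = q' ^ N * gdet0 scale n A r X0'"
  then obtain \<delta> p Y0 where "\<delta> \<in> Even_degs n" and g: "factorization n A r \<delta> X p Y0"
    and d: "d = p ^ N * gdet0 scale n A r Y0" by blast
  moreover have "Y0 \<in> M0" using g by (simp add: factorization_def)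
  ultimately show "d = q ^ N * det0 X0"
    using factorization_value_unique[OF \<gamma> _ f g] by (simp add: gdet0_eq_det0)
qed

lemma gdet_mem:
  assumes "\<gamma> \<in> Even_degs n" "X \<in> graded_mats n A r \<gamma>"
  shows "gdet scale n A r X \<in> A (((\<oplus>\<^sub>d) \<gamma> ^^ N) (deg_zero n))"
proof -
  obtain q X0 where f: "factorization n A r \<gamma> X q X0" using factorization_exists[OF assms] by blast
  then have q: "q \<in> A \<gamma>" and X0: "X0 \<in> M0" by (simp_all add: factorization_def)
  note pow = component_power[OF assms(1) q, of N]
  show ?thesis
    unfolding gdet_factorization[OF assms(1) f]
    using component_mult[OF conjunct2[OF pow] deg_zero_even conjunct1[OF pow] det0_mem[OF X0]] pow
    by simp
qed

text \<open>The sign in the graded scalar multiplication is made so that \<open>(q X0) (p Y0) = (q p) (X0 Y0)\<close>: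
  moving \<open>p\<close> past the entry \<open>(i, k)\<close> of \<open>X0\<close> costs the sign of \<open>\<rho> i + \<rho> k\<close>, whose part at \<open>k\<close> is cancelled by the sign from
  \<open>p Y0\<close>.\<close>

lemma factorization_mult:
  assumes \<gamma>: "\<gamma> \<in> Even_degs n" and \<delta>: "\<delta> \<in> Even_degs n"
    and fX: "factorization n A r \<gamma> X q X0" and fY: "factorization n A r \<delta> Y p Y0"
  shows "factorization n A r (\<gamma> \<oplus>\<^sub>d \<delta>) (X * Y) (q * p) (X0 * Y0)"
proof -
  from fX obtain q' where q: "q \<in> A \<gamma>" "q * q' = 1" "q' * q = 1" and X0: "X0 \<in> M0"
    and X: "X = graded_smult n r \<gamma> q X0"
    by (auto simp: factorization_def invertible_elem_def)
  from fY obtain p' where p: "p \<in> A \<delta>" "p * p' = 1" "p' * p = 1" and Y0: "Y0 \<in> M0"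
    and Y: "Y = graded_smult n r \<delta> p Y0"
    by (auto simp: factorization_def invertible_elem_def)
  note c = M0_carrier[OF X0] M0_carrier[OF Y0]
  have "q * p * (p' * q') = q * (p * p') * q'" "p' * q' * (q * p) = p' * (q' * q) * p"
    by (simp_all only: mult.assoc)
  then have "invertible_elem (q * p)"
    unfolding invertible_elem_def using q p by (intro exI[of _ "p' * q'"]) simp
  moreover have "X * Y = graded_smult n r (\<gamma> \<oplus>\<^sub>d \<delta>) (q * p) (X0 * Y0)"
  proof (rule eq_matI)
    fix i j assume "i < dim_row (graded_smult n r (\<gamma> \<oplus>\<^sub>d \<delta>) (q * p) (X0 * Y0))"
      "j < dim_col (graded_smult n r (\<gamma> \<oplus>\<^sub>d \<delta>) (q * p) (X0 * Y0))"
    then have ij: "i < N" "j < N" by (simp_all add: graded_smult_def)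
    define g :: "degree \<Rightarrow> nat \<Rightarrow> 'a" where "g \<epsilon> k = gsign \<epsilon> (\<rho> k)" for \<epsilon> k
    have g: "g \<epsilon> k * x = x * g \<epsilon> k" for \<epsilon> k x unfolding g_def by (rule centralD) simp
    have "g \<gamma> i * q * X0 $$ (i, k) * (g \<delta> k * p * Y0 $$ (k, j)) =
        g (\<gamma> \<oplus>\<^sub>d \<delta>) i * (q * p) * (X0 $$ (i, k) * Y0 $$ (k, j))" if k: "k < N" for k
    proof -
      have "X0 $$ (i, k) * p = gsign \<delta> (\<rho> i \<oplus>\<^sub>d \<rho> k) * (p * X0 $$ (i, k))"
        using graded_commute[of \<delta> "\<rho> i \<oplus>\<^sub>d \<rho> k" p "X0 $$ (i, k)"] \<delta> ij k p(1) M0D[OF X0 ij(1) k] by simp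
      also have "gsign \<delta> (\<rho> i \<oplus>\<^sub>d \<rho> k) = g \<delta> i * g \<delta> k"
        using ij k by (simp add: gsign_commute[of \<delta>] gsign_add_left[of "\<rho> i" "\<rho> k"] length_Even_degs[where n = n] g_def)
      finally have swap: "X0 $$ (i, k) * p = g \<delta> i * g \<delta> k * (p * X0 $$ (i, k))" .
      have "g \<gamma> i * q * X0 $$ (i, k) * (g \<delta> k * p * Y0 $$ (k, j)) =
          g \<gamma> i * q * (X0 $$ (i, k) * p) * g \<delta> k * Y0 $$ (k, j)"
        unfolding g[of \<delta> k p] by (simp only: mult.assoc)
      also have "\<dots> = g \<gamma> i * (q * g \<delta> i) * (g \<delta> k * (p * X0 $$ (i, k)) * g \<delta> k) * Y0 $$ (k, j)"
        by (simp only: swap mult.assoc)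
      also have "g \<delta> k * (p * X0 $$ (i, k)) * g \<delta> k = p * X0 $$ (i, k)"
        unfolding g[of \<delta> k "p * X0 $$ (i, k)"] by (simp add: g_def mult.assoc)
      also have "g \<gamma> i * (q * g \<delta> i) * (p * X0 $$ (i, k)) * Y0 $$ (k, j) =
          g \<gamma> i * g \<delta> i * (q * p) * (X0 $$ (i, k) * Y0 $$ (k, j))"
        by (simp only: g[of \<delta> i q, symmetric] mult.assoc)
      also have "g \<gamma> i * g \<delta> i = g (\<gamma> \<oplus>\<^sub>d \<delta>) i"
        using \<gamma> \<delta> by (simp add: g_def gsign_add_left length_Even_degs[where n = n])
      finally show ?thesis .
    qed
    then have "(\<Sum>k\<in>{0..<N}. g \<gamma> i * q * X0 $$ (i, k) * (g \<delta> k * p * Y0 $$ (k, j))) =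
        g (\<gamma> \<oplus>\<^sub>d \<delta>) i * (q * p) * (\<Sum>k\<in>{0..<N}. X0 $$ (i, k) * Y0 $$ (k, j))"
      by (simp add: sum_distrib_left)
    then show "(X * Y) $$ (i, j) = graded_smult n r (\<gamma> \<oplus>\<^sub>d \<delta>) (q * p) (X0 * Y0) $$ (i, j)"
      using ij c unfolding X Y by (simp add: graded_smult_def scalar_prod_def g_def)
  qed (auto simp: X Y graded_smult_def)
  ultimately show ?thesis
    unfolding factorization_def using component_mult[OF \<gamma> \<delta> q(1) p(1)] M0_mult[OF X0 Y0] by simp
qed

text \<open>This is the whole obstruction to multiplicativity: the exponent \<open>\<Sum>i<N. i\<close> is
  \<open>N * (N - 1) / 2\<close>, which is even exactly if \<open>N\<close> is \<open>0\<close> or \<open>1\<close> modulo \<open>4\<close>.\<close>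

lemma gdet_mult:
  assumes \<gamma>: "\<gamma> \<in> Even_degs n" and \<delta>: "\<delta> \<in> Even_degs n"
    and X: "X \<in> graded_mats n A r \<gamma>" and Y: "Y \<in> graded_mats n A r \<delta>"
  shows "gdet scale n A r (X * Y) =
    gsign \<gamma> \<delta> ^ (\<Sum>i<N. i) * (gdet scale n A r X * gdet scale n A r Y)"
proof -
  obtain q X0 where fX: "factorization n A r \<gamma> X q X0" using factorization_exists[OF \<gamma> X] by blast
  obtain p Y0 where fY: "factorization n A r \<delta> Y p Y0" using factorization_exists[OF \<delta> Y] by blast
  have q: "q \<in> A \<gamma>" and X0: "X0 \<in> M0" and p: "p \<in> A \<delta>" and Y0: "Y0 \<in> M0"
    using fX fY by (simp_all add: factorization_def)
  have "gdet scale n A r (X * Y) = (q * p) ^ N * (det0 X0 * det0 Y0)"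
    using gdet_factorization[OF _ factorization_mult[OF \<gamma> \<delta> fX fY]] \<gamma> \<delta>
    by (simp add: det0_mult X0 Y0)
  also have "(q * p) ^ N = gsign \<gamma> \<delta> ^ (\<Sum>i<N. i) * (q ^ N * p ^ N)"
    by (rule power_mult_anticommuting[OF graded_commute[OF \<gamma> \<delta> q p] central_gsign])
  also have "gsign \<gamma> \<delta> ^ (\<Sum>i<N. i) * (q ^ N * p ^ N) * (det0 X0 * det0 Y0) =
      gsign \<gamma> \<delta> ^ (\<Sum>i<N. i) * (q ^ N * (p ^ N * det0 X0) * det0 Y0)"
    by (simp only: mult.assoc)
  also have "p ^ N * det0 X0 = det0 X0 * p ^ N"
    using centralD[OF central_component_zero[OF det0_mem[OF X0]]] by simp
  finally show ?thesis
    by (simp add: gdet_factorization[OF \<gamma> fX] gdet_factorization[OF \<delta> fY] mult.assoc)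
qed

lemma gdet_multiplicative_if:
  assumes "N mod 4 \<in> {0, 1}"
  shows "gdet_multiplicative scale n A r"
  unfolding gdet_multiplicative_def
proof (intro ballI)
  fix \<gamma> \<delta> X Y
  assume *: "\<gamma> \<in> Even_degs n" "\<delta> \<in> Even_degs n" "X \<in> graded_mats n A r \<gamma>" "Y \<in> graded_mats n A r \<delta>"
  have "(gsign \<gamma> \<delta> :: 'a) ^ (\<Sum>i<N. i) = 1"
    using assms by (simp add: gsign_def minus_one_power_sum_lessThan)
  then show "gdet scale n A r (X * Y) = gdet scale n A r X * gdet scale n A r Y"
    using gdet_mult[OF *] by simp
qed

text \<open>Three coordinates are enough for two even degrees with scalar product \<open>1\<close>, and the matrices \<open>q 1\<close> and
  \<open>p 1\<close> of these degrees then violate multiplicativity.\<close>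

lemma not_gdet_multiplicative:
  assumes n: "3 \<le> n" and N: "N mod 4 \<notin> {0, 1}"
  shows "\<not> gdet_multiplicative scale n A r"
proof
  assume mult: "gdet_multiplicative scale n A r"
  obtain m where m: "n = Suc (Suc (Suc m))" using n by (metis Suc_le_D numeral_3_eq_3 Suc_le_mono)
  \<comment> \<open>These two degrees overlap in one coordinate only.\<close>
  define \<gamma> \<delta> :: degree where "\<gamma> = 1 # 1 # 0 # replicate m 0" and "\<delta> = 0 # 1 # 1 # replicate m 0"
  have zero: "sum_list (replicate m (0 :: bit)) = 0"
    by (induction m) auto
  have \<gamma>: "\<gamma> \<in> Even_degs n" and \<delta>: "\<delta> \<in> Even_degs n" and "sprod \<gamma> \<delta> \<noteq> 0"
    by (simp_all add: Even_degs_iff m \<gamma>_def \<delta>_def sprod_def zero)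
  then have sign: "(gsign \<gamma> \<delta> :: 'a) ^ (\<Sum>i<N. i) = - 1"
    using N by (simp add: gsign_def minus_one_power_sum_lessThan)
  obtain q q' where q: "q \<in> A \<gamma>" "q * q' = 1" "q' * q = 1"
    using units[OF \<gamma>] by (auto simp: invertible_elem_def)
  obtain p p' where p: "p \<in> A \<delta>" "p * p' = 1" "p' * p = 1"
    using units[OF \<delta>] by (auto simp: invertible_elem_def)
  let ?X = "graded_smult n r \<gamma> q (1\<^sub>m N)" and ?Y = "graded_smult n r \<delta> p (1\<^sub>m N)"
  have X: "?X \<in> graded_mats n A r \<gamma>" and Y: "?Y \<in> graded_mats n A r \<delta>"
    using graded_smult_mem[OF \<gamma> deg_zero_even q(1) det0_one(1)]
      graded_smult_mem[OF \<delta> deg_zero_even p(1) det0_one(1)] \<gamma> \<delta> by simp_all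
  have "factorization n A r \<gamma> ?X q (1\<^sub>m N)" "factorization n A r \<delta> ?Y p (1\<^sub>m N)"
    using q p det0_one(1) by (auto simp: factorization_def invertible_elem_def)
  then have gX: "gdet scale n A r ?X = q ^ N" and gY: "gdet scale n A r ?Y = p ^ N"
    using gdet_factorization[OF \<gamma>] gdet_factorization[OF \<delta>] det0_one(2) by simp_all
  define y where "y = q ^ N * p ^ N"
  have "- y = y"
    using gdet_mult[OF \<gamma> \<delta> X Y] mult \<gamma> \<delta> X Y
    by (simp add: gdet_multiplicative_def sign gX gY y_def)
  then have "scale (1 + 1) y = 0"
    by (metis add.left_inverse scale_left_distrib scale_one)
  then have "y = 0" by simp
  moreover have "y * (p' ^ N * q' ^ N) = q ^ N * (p ^ N * p' ^ N) * q' ^ N"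
    by (simp only: y_def mult.assoc)
  then have "y * (p' ^ N * q' ^ N) = 1"
    using left_right_inverse_power[OF p(2), of N] left_right_inverse_power[OF q(2), of N] by simp
  ultimately show False by simp
qed

end

section \<open>Multiplicativity modulo four\<close>

theorem proposition7p2:
  fixes scale :: "'k::field_char_0 \<Rightarrow> 'a::ring_1 \<Rightarrow> 'a"
    and n :: nat and A :: "degree \<Rightarrow> 'a set" and r :: "nat list"
  assumes "1 \<le> n"
    and "graded_comm_algebra scale n A"
    and "\<forall>\<gamma>\<in>Even_degs n. \<exists>q\<in>A \<gamma>. invertible_elem q"
    and "length r = 2 ^ (n - 1)"
  shows "(\<forall>\<gamma>\<in>Even_degs n. \<forall>X\<in>graded_mats n A r \<gamma>.
            (\<exists>q X0. factorization n A r \<gamma> X q X0) \<and>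
            (\<forall>q X0. factorization n A r \<gamma> X q X0 \<longrightarrow>
               gdet scale n A r X = q ^ sum_list r * gdet0 scale n A r X0) \<and>
            gdet scale n A r X \<in> A (((\<oplus>\<^sub>d) \<gamma> ^^ sum_list r) (deg_zero n))) \<and>
         (sum_list r mod 4 \<in> {0, 1} \<longrightarrow> gdet_multiplicative scale n A r) \<and>
         (3 \<le> n \<longrightarrow>
            (gdet_multiplicative scale n A r \<longleftrightarrow> sum_list r mod 4 \<in> {0, 1}))"
proof -
  interpret graded_comm_algebra scale n A by (rule assms(2))
  interpret crossed_graded_algebra scale n A r
    by unfold_locales (use assms in auto)
  show ?thesis
  proof (intro conjI ballI allI impI)
    fix \<gamma> X assume \<gamma>: "\<gamma> \<in> Even_degs n" and X: "X \<in> graded_mats n A r \<gamma>"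
    show "\<exists>q X0. factorization n A r \<gamma> X q X0" by (rule factorization_exists[OF \<gamma> X])
    show "gdet scale n A r X \<in> A (((\<oplus>\<^sub>d) \<gamma> ^^ sum_list r) (deg_zero n))" by (rule gdet_mem[OF \<gamma> X])
    fix q X0 assume f: "factorization n A r \<gamma> X q X0"
    then have "X0 \<in> M0" by (simp add: factorization_def)
    then show "gdet scale n A r X = q ^ sum_list r * gdet0 scale n A r X0"
      by (simp add: gdet_factorization[OF \<gamma> f] gdet0_eq_det0)
  next
    show "gdet_multiplicative scale n A r" if "sum_list r mod 4 \<in> {0, 1}"
      using that by (rule gdet_multiplicative_if)
  next
    show "gdet_multiplicative scale n A r \<longleftrightarrow> sum_list r mod 4 \<in> {0, 1}" if "3 \<le> n"
    proof (cases "sum_list r mod 4 \<in> {0, 1}")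
      case True
      then show ?thesis by (simp only: gdet_multiplicative_if)
    next
      case False
      have "\<not> gdet_multiplicative scale n A r" by (rule not_gdet_multiplicative[OF that False])
      then show ?thesis using False by (simp only: simp_thms)
    qed
  qed
qed


end
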